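(* Let $\varepsilon=\varepsilon(n)$, $\beta=\beta(n)$, $\gamma=\gamma(n)$ take values in $(0,1)$ and satisfy $\beta \le \frac{\varepsilon}{14}$ and $\varepsilon = \Omega\!\left(n^{-0.0019}\right)$. Then there exists a gossip algorithm using messages of size $O(\log n)$ that, in the presence of a $\beta$-strong adversary, solves the $\varepsilon$-approximate median problem with correctness level $\gamma$ with high probability, in $$O\!\left(\log \frac{1}{\varepsilon} + \log\log\frac{1}{\gamma} + \frac{\log(1/\gamma)}{\log(1/\beta)}\right)$$ rounds.
   Context: Gossip model: there are $n$ nodes, every pair of which can communicate (complete graph). Each node initially holds a value that is polynomially bounded in $n$. Communication proceeds in synchronous rounds; in each round every node chooses a node uniformly at random (possibly itself) and either pushes a message to it or pulls a message from it; messages have a stated bit size. $\beta$-strong adversary: at the beginning of each round the adversary chooses at most $\beta n$ nodes; any message pulled from or pushed to these nodes in that round can be replaced arbitrarily by the adversary. The adversary does not know in advance the random choice of communication partners in the current round, but otherwise is unrestricted (unbounded computational power, knows the full history of the execution). $\varepsilon$-approximate median problem: each node must output a value whose rank among the $n$ initial values lies in $[(1/2-\varepsilon)n,(1/2+\varepsilon)n]$. Correctness level $\gamma$: upon termination at most $\gamma n$ nodes hold (output) an incorrect value. "With high probability" means with probability $1-n^{-\Omega(1)}$. *)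

theory Defs
  imports
    "HOL-Probability.Probability"
    "HOL-Probability.Product_PMF"
    "HOL-Library.Landau_Symbols"
begin

text \<open>
  The nodes are the numbers below \<open>n\<close>. All nodes run the same program, which does not see node
  identities; \<open>'s\<close> is the type of local memory contents. The size of a message is the length of
  the bit string.
\<close>

type_synonym message = "bool list"

datatype action = Push message | Pull

text \<open>
  Local coins are tossed by \<open>flip\<close> at the start of each round, so that their outcome is already
  visible to the adversary when it acts in that round; everything else a node does is determined by
  its state. \<open>reply\<close> is what a node hands out when others pull from it. \<open>update\<close> receives the answer
  to the node's own pull (if it pulled) and the multiset of messages pushed to the node.
\<close>

record 's gossip_algorithm =
  init :: "int \<Rightarrow> 's"
  flip :: "'s \<Rightarrow> 's pmf"
  action :: "'s \<Rightarrow> action"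
  reply :: "'s \<Rightarrow> message"
  update :: "'s \<Rightarrow> message option \<Rightarrow> message multiset \<Rightarrow> 's"
  outcome :: "'s \<Rightarrow> int"

definition message_size_le :: "'s gossip_algorithm \<Rightarrow> nat \<Rightarrow> bool" where
  "message_size_le A b \<longleftrightarrow>
     (\<forall>s. length (reply A s) \<le> b \<and> (\<forall>m. action A s = Push m \<longrightarrow> length m \<le> b))"

text \<open>
  One round as seen by the adversary: the states of the nodes after their coin tosses, the attacked
  nodes, the communication partners, and the replacement messages. A history lists the completed
  rounds, most recent first.
\<close>

type_synonym 's round_log = "(nat \<Rightarrow> 's) \<times> nat set \<times> (nat \<Rightarrow> nat) \<times> (nat \<Rightarrow> message)"
type_synonym 's history = "'s round_log list"

text \<open>
  The adversary may randomize. \<open>attack\<close> chooses the attacked nodes from the history and the current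
  states, before the communication partners of the round are drawn; \<open>forge\<close> chooses the replacement
  messages and may depend on the partners as well. Replacements are indexed by the node that
  initiates the communication, as each node initiates exactly one per round, and they need not
  respect the message size.
\<close>

record 's adversary =
  attack :: "'s history \<Rightarrow> (nat \<Rightarrow> 's) \<Rightarrow> nat set pmf"
  forge :: "'s history \<Rightarrow> (nat \<Rightarrow> 's) \<Rightarrow> nat set \<Rightarrow> (nat \<Rightarrow> nat) \<Rightarrow> (nat \<Rightarrow> message) pmf"

definition strong_adversary :: "nat \<Rightarrow> real \<Rightarrow> 's adversary \<Rightarrow> bool" where
  "strong_adversary n \<beta> adv \<longleftrightarrow>
     (\<forall>h \<sigma>. \<forall>B \<in> set_pmf (attack adv h \<sigma>). B \<subseteq> {..<n} \<and> real (card B) \<le> \<beta> * real n)"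

text \<open>
  The message arriving in the communication initiated by \<open>u\<close>, who contacts \<open>p u\<close>. Whether \<open>u\<close> pushes
  or pulls, the message can be replaced iff the contacted node \<open>p u\<close> is attacked.
\<close>

definition transmitted ::
  "'s gossip_algorithm \<Rightarrow> (nat \<Rightarrow> 's) \<Rightarrow> nat set \<Rightarrow> (nat \<Rightarrow> nat) \<Rightarrow> (nat \<Rightarrow> message) \<Rightarrow> nat \<Rightarrow> message"
where
  "transmitted A \<sigma> B p f u =
     (if p u \<in> B then f u
      else (case action A (\<sigma> u) of Push m \<Rightarrow> m | Pull \<Rightarrow> reply A (\<sigma> (p u))))"

definition pull_answer ::
  "'s gossip_algorithm \<Rightarrow> (nat \<Rightarrow> 's) \<Rightarrow> nat set \<Rightarrow> (nat \<Rightarrow> nat) \<Rightarrow> (nat \<Rightarrow> message) \<Rightarrow> nat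
     \<Rightarrow> message option"
where
  "pull_answer A \<sigma> B p f v =
     (if action A (\<sigma> v) = Pull then Some (transmitted A \<sigma> B p f v) else None)"

definition pushes_received ::
  "nat \<Rightarrow> 's gossip_algorithm \<Rightarrow> (nat \<Rightarrow> 's) \<Rightarrow> nat set \<Rightarrow> (nat \<Rightarrow> nat) \<Rightarrow> (nat \<Rightarrow> message) \<Rightarrow> nat
     \<Rightarrow> message multiset"
where
  "pushes_received n A \<sigma> B p f v =
     image_mset (transmitted A \<sigma> B p f)
       (mset_set {u. u < n \<and> p u = v \<and> action A (\<sigma> u) \<noteq> Pull})"

definition next_states ::
  "nat \<Rightarrow> 's gossip_algorithm \<Rightarrow> (nat \<Rightarrow> 's) \<Rightarrow> nat set \<Rightarrow> (nat \<Rightarrow> nat) \<Rightarrow> (nat \<Rightarrow> message)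
     \<Rightarrow> nat \<Rightarrow> 's"
where
  "next_states n A \<sigma> B p f v =
     update A (\<sigma> v) (pull_answer A \<sigma> B p f v) (pushes_received n A \<sigma> B p f v)"

definition random_partners :: "nat \<Rightarrow> (nat \<Rightarrow> nat) pmf" where
  "random_partners n = Pi_pmf {..<n} undefined (\<lambda>_. pmf_of_set {..<n})"

definition gossip_round ::
  "nat \<Rightarrow> 's gossip_algorithm \<Rightarrow> 's adversary \<Rightarrow> (nat \<Rightarrow> 's) \<times> 's history
     \<Rightarrow> ((nat \<Rightarrow> 's) \<times> 's history) pmf"
where
  "gossip_round n A adv = (\<lambda>(\<sigma>\<^sub>0, h).
     bind_pmf (Pi_pmf {..<n} undefined (\<lambda>v. flip A (\<sigma>\<^sub>0 v))) (\<lambda>\<sigma>.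
     bind_pmf (attack adv h \<sigma>) (\<lambda>B.
     bind_pmf (random_partners n) (\<lambda>p.
     bind_pmf (forge adv h \<sigma> B p) (\<lambda>f.
     return_pmf (next_states n A \<sigma> B p f, (\<sigma>, B, p, f) # h))))))"

primrec execution ::
  "nat \<Rightarrow> 's gossip_algorithm \<Rightarrow> 's adversary \<Rightarrow> (nat \<Rightarrow> int) \<Rightarrow> nat
     \<Rightarrow> ((nat \<Rightarrow> 's) \<times> 's history) pmf"
where
  "execution n A adv x 0 = return_pmf (\<lambda>v. init A (x v), [])"
| "execution n A adv x (Suc t) = bind_pmf (execution n A adv x t) (gossip_round n A adv)"

definition outputs ::
  "nat \<Rightarrow> 's gossip_algorithm \<Rightarrow> 's adversary \<Rightarrow> (nat \<Rightarrow> int) \<Rightarrow> nat \<Rightarrow> (nat \<Rightarrow> int) pmf"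
where
  "outputs n A adv x T = map_pmf (\<lambda>(\<sigma>, h) v. outcome A (\<sigma> v)) (execution n A adv x T)"

text \<open>
  With ties, an initial value \<open>y\<close> occupies all the ranks from \<open>min_rank n x y\<close> to \<open>max_rank n x y\<close>,
  and it is acceptable if that range meets the prescribed interval. If the initial values are
  distinct, both numbers are the rank of \<open>y\<close>. Values that no node held initially may be output too,
  since forged messages can introduce them; these satisfy \<open>min_rank n x y = max_rank n x y + 1\<close>, and
  both numbers must then lie in the interval, i.e. \<open>y\<close> must lie between two initial values of
  prescribed rank.
\<close>

definition min_rank :: "nat \<Rightarrow> (nat \<Rightarrow> int) \<Rightarrow> int \<Rightarrow> nat" where
  "min_rank n x y = card {v. v < n \<and> x v < y} + 1"

definition max_rank :: "nat \<Rightarrow> (nat \<Rightarrow> int) \<Rightarrow> int \<Rightarrow> nat" where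
  "max_rank n x y = card {v. v < n \<and> x v \<le> y}"

definition approx_median :: "nat \<Rightarrow> (nat \<Rightarrow> int) \<Rightarrow> real \<Rightarrow> int \<Rightarrow> bool" where
  "approx_median n x \<epsilon> y \<longleftrightarrow>
     (1/2 - \<epsilon>) * real n \<le> real (max_rank n x y) \<and>
     real (min_rank n x y) \<le> (1/2 + \<epsilon>) * real n"

definition correctness_level :: "nat \<Rightarrow> (nat \<Rightarrow> int) \<Rightarrow> real \<Rightarrow> real \<Rightarrow> (nat \<Rightarrow> int) \<Rightarrow> bool" where
  "correctness_level n x \<epsilon> \<gamma> y \<longleftrightarrow>
     real (card {v. v < n \<and> \<not> approx_median n x \<epsilon> (y v)}) \<le> \<gamma> * real n"

text \<open>
  The bound \<open>n ^ k\<close> expresses that the initial values are polynomially bounded. The failure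
  probability bound \<open>n powr - c\<close> is uniform over the inputs and the adversaries.
\<close>

definition solves_approx_median_whp ::
  "(nat \<Rightarrow> 's gossip_algorithm) \<Rightarrow> (nat \<Rightarrow> nat) \<Rightarrow> nat
     \<Rightarrow> (nat \<Rightarrow> real) \<Rightarrow> (nat \<Rightarrow> real) \<Rightarrow> (nat \<Rightarrow> real) \<Rightarrow> bool"
where
  "solves_approx_median_whp A T k \<epsilon> \<beta> \<gamma> \<longleftrightarrow>
     (\<exists>c > 0. \<forall>\<^sub>F n in sequentially. \<forall>x adv.
        (\<forall>v < n. \<bar>x v\<bar> \<le> int n ^ k) \<longrightarrow> strong_adversary n (\<beta> n) adv \<longrightarrow>
        measure_pmf.prob (outputs n (A n) adv x (T n)) {y. correctness_level n x (\<epsilon> n) (\<gamma> n) y}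
          \<ge> 1 - real n powr (- c))"

text \<open>
  The double logarithm is negative for \<open>\<gamma> > exp (- 1)\<close> and unbounded below as \<open>\<gamma>\<close> tends to 1, so it
  is truncated at 0.
\<close>

definition round_bound :: "real \<Rightarrow> real \<Rightarrow> real \<Rightarrow> real" where
  "round_bound \<epsilon> \<beta> \<gamma> = ln (1 / \<epsilon>) + max 0 (ln (ln (1 / \<gamma>))) + ln (1 / \<gamma>) / ln (1 / \<beta>)"

end

theory Submission
  imports Defs "HOL-Real_Asymp.Real_Asymp"
begin

text \<open>
  Every node always pulls. In a tournament phase a node replaces its value by the median of three
  samples; after \<open>m\<close> such phases it outputs the median of a longer odd number of samples. A median
  is above a threshold only if a majority of the samples is, so the values of too high rank and those
  of too low rank can be treated separately: if a fraction \<open>p\<close> of the nodes is bad at the beginning of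
  a phase, each sample is bad with conditional probability at most \<open>q = p + \<beta>\<close>, whatever the
  adversary does. The conditional probability \<open>\<phi> v\<close> that a majority of the samples of \<open>v\<close> will be bad
  then yields a supermartingale \<open>\<Prod>v. 1 + a \<phi> v\<close>, since the partners of a round are independent; it
  bounds the exponential moments of the number of bad nodes after the phase.

  The bad fraction thus follows the recursion \<open>p \<mapsto> 3 q\<^sup>2 - 2 q\<^sup>3\<close> up to a small error. Starting from
  \<open>1/2 - \<epsilon>\<close>, it leaves the neighbourhood of \<open>1/2\<close> geometrically, in \<open>O(ln (1/\<epsilon>))\<close> phases, and is then
  essentially squared in every phase until it is of order \<open>\<beta>\<close> or \<open>\<gamma>\<close>. The final phase
  brings it down to \<open>\<gamma>\<close> with \<open>O(1 + ln (1/\<gamma>) / ln (1/\<beta>))\<close> samples.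
\<close>

subsection \<open>Medians and messages\<close>

definition median :: "int list \<Rightarrow> int" where
  "median xs = sort xs ! (length xs div 2)"

text \<open>The analysis sees a set of bad values only through this property. Odd length makes the
  middle entry unique and excludes a tied vote.\<close>

definition majority_closed :: "(int \<Rightarrow> bool) \<Rightarrow> bool" where
  "majority_closed P \<longleftrightarrow>
     (\<forall>xs. odd (length xs) \<longrightarrow> P (median xs) \<longrightarrow> length xs < 2 * length (filter P xs))"

lemma median_in_set: "xs \<noteq> [] \<Longrightarrow> median xs \<in> set xs"
  unfolding median_def
  by (metis div_less_dividend length_greater_0_conv length_sort nth_mem one_less_numeral_iff
      semiring_norm(76) set_sort)

lemma length_filter_sort: "length (filter P (sort xs)) = length (filter P xs)"
  by (metis mset_filter mset_sort size_mset)

text \<open>In a sorted list of \<open>2 * k + 1\<close> entries, the median and the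
  \<open>k\<close> entries after it all inherit \<open>P\<close>, which makes \<open>k + 1\<close>
  of them.\<close>

lemma majority_closed_up:
  assumes up: "\<And>y z. P y \<Longrightarrow> y \<le> z \<Longrightarrow> P z"
  shows "majority_closed P"
  unfolding majority_closed_def
proof (intro allI impI)
  fix xs :: "int list"
  assume odd: "odd (length xs)" and med: "P (median xs)"
  define k where "k = length xs div 2"
  have k: "length xs = 2 * k + 1" using odd by (simp add: k_def)
  have "filter P (drop k (sort xs)) = drop k (sort xs)"
  proof (intro filter_True ballI)
    fix z assume "z \<in> set (drop k (sort xs))"
    then obtain i where "i < length (drop k (sort xs))" "z = drop k (sort xs) ! i"
      by (metis in_set_conv_nth)
    then have "sort xs ! k \<le> z"
      using k by (auto intro!: sorted_nth_mono)
    then show "P z" using up med by (auto simp: median_def k_def)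
  qed
  then have "length (drop k (sort xs)) \<le> length (filter P (sort xs))"
    by (metis append_take_drop_id filter_append le_add2 length_append)
  then show "length xs < 2 * length (filter P xs)"
    using k by (simp add: length_filter_sort)
qed

lemma majority_closed_down:
  assumes down: "\<And>y z. P y \<Longrightarrow> z \<le> y \<Longrightarrow> P z"
  shows "majority_closed P"
  unfolding majority_closed_def
proof (intro allI impI)
  fix xs :: "int list"
  assume odd: "odd (length xs)" and med: "P (median xs)"
  define k where "k = length xs div 2"
  have k: "length xs = 2 * k + 1" using odd by (simp add: k_def)
  have "filter P (take (Suc k) (sort xs)) = take (Suc k) (sort xs)"
  proof (intro filter_True ballI)
    fix z assume "z \<in> set (take (Suc k) (sort xs))"
    then obtain i where "i < length (take (Suc k) (sort xs))" "z = take (Suc k) (sort xs) ! i"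
      by (metis in_set_conv_nth)
    then have "z \<le> sort xs ! k"
      using k by (auto intro!: sorted_nth_mono)
    then show "P z" using down med by (auto simp: median_def k_def)
  qed
  then have "length (take (Suc k) (sort xs)) \<le> length (filter P (sort xs))"
    by (metis append_take_drop_id filter_append le_add1 length_append)
  then show "length xs < 2 * length (filter P xs)"
    using k by (simp add: length_filter_sort)
qed

text \<open>The value of a node with initial value \<open>y\<close> and samples \<open>zs\<close>, most recent first; the number of
  samples is the time. A phase of length \<open>K > 0\<close> ends at time \<open>t\<close> iff \<open>ph t = K\<close>.\<close>

primrec current :: "(nat \<Rightarrow> nat) \<Rightarrow> int \<Rightarrow> int list \<Rightarrow> int" where
  "current ph y [] = y"
| "current ph y (z # zs) =
     (if ph (Suc (length zs)) = 0 then current ph y zs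
      else median (take (ph (Suc (length zs))) (z # zs)))"

text \<open>Memory contents are coded as natural numbers, the state type used in the theorem;
  \<open>from_nat\<close> recovers the initial value and the list of samples. Memory may grow
  without limit, since only messages are bounded in size.\<close>

definition own :: "nat \<Rightarrow> int" where
  "own s = fst (from_nat s :: int \<times> int list)"

definition samples :: "nat \<Rightarrow> int list" where
  "samples s = snd (from_nat s :: int \<times> int list)"

definition estimate :: "(nat \<Rightarrow> nat) \<Rightarrow> nat \<Rightarrow> int" where
  "estimate ph s = current ph (own s) (samples s)"

text \<open>\<open>flip\<close> is trivial, so the only randomness on the side of the nodes lies in
  the partners. Throughout a phase a node keeps handing out its value from before the phase.\<close>

definition median_algorithm ::
  "(int \<Rightarrow> message) \<Rightarrow> (message \<Rightarrow> int) \<Rightarrow> (nat \<Rightarrow> nat) \<Rightarrow> nat gossip_algorithm" where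
  "median_algorithm enc dec ph =
     \<lparr> init = (\<lambda>y. to_nat (y, [] :: int list)),
       flip = return_pmf,
       action = (\<lambda>_. Pull),
       reply = (\<lambda>s. enc (estimate ph s)),
       update = (\<lambda>s a _. case a of None \<Rightarrow> s | Some m \<Rightarrow> to_nat (own s, dec m # samples s)),
       outcome = estimate ph \<rparr>"

lemma own_to_nat [simp]: "own (to_nat (y, zs)) = y"
  and samples_to_nat [simp]: "samples (to_nat (y, zs)) = zs"
  by (simp_all add: own_def samples_def)

text \<open>A median is one of its samples, so values stay inside the range in which messages decode
  correctly.\<close>

lemma current_range:
  assumes "\<bar>y\<bar> \<le> M" "\<And>z. z \<in> set zs \<Longrightarrow> \<bar>z\<bar> \<le> M"
  shows "\<bar>current ph y zs\<bar> \<le> M"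
  using assms(2)
proof (induction zs)
  case Nil
  then show ?case using assms(1) by simp
next
  case (Cons z zs)
  show ?case
  proof (cases "ph (Suc (length zs)) = 0")
    case True
    then show ?thesis using Cons by simp
  next
    case False
    then have "take (ph (Suc (length zs))) (z # zs) \<noteq> []" by simp
    then have "median (take (ph (Suc (length zs))) (z # zs)) \<in> set (z # zs)"
      by (meson in_set_takeD median_in_set)
    then have "current ph y (z # zs) \<in> set (z # zs)" using False by simp
    then show ?thesis using Cons.prems by blast
  qed
qed

text \<open>The bound on the decoded value holds for every bit string, so forged messages of any
  length cannot push values out of range. The length bound holds for every integer, because message
  size is judged on all states, reachable or not.\<close>

definition is_codec :: "nat \<Rightarrow> int \<Rightarrow> (int \<Rightarrow> message) \<times> (message \<Rightarrow> int) \<Rightarrow> bool" where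
  "is_codec b M c \<longleftrightarrow> (\<forall>y. length (fst c y) \<le> b) \<and> (\<forall>m. \<bar>snd c m\<bar> \<le> M) \<and>
     (\<forall>y. \<bar>y\<bar> \<le> M \<longrightarrow> snd c (fst c y) = y)"

lemma is_codecD:
  assumes "is_codec b M c"
  shows "length (fst c y) \<le> b" "\<bar>snd c m\<bar> \<le> M" "\<bar>y\<bar> \<le> M \<Longrightarrow> snd c (fst c y) = y"
  using assms unfolding is_codec_def by blast+

lemma codec_exists:
  assumes "2 * M + 1 \<le> 2 ^ b" "M \<ge> 0"
  shows "\<exists>c. is_codec b M c"
proof -
  let ?B = "{xs :: bool list. length xs = b}"
  have cB: "card ?B = 2 ^ b" "finite ?B"
    using card_lists_length_eq[of "UNIV :: bool set" b] finite_lists_length_eq[of "UNIV :: bool set" b]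
    by simp_all
  have "int (card {-M..M}) \<le> int (2 ^ b)" using assms by simp
  then have "card {-M..M} \<le> card ?B" unfolding cB(1) by linarith
  then obtain f where f: "f ` {-M..M} \<subseteq> ?B" "inj_on f {-M..M}"
    using card_le_inj[OF finite_atLeastAtMost_int cB(2)] by blast
  \<comment> \<open>Out of range, the empty string keeps the length bound; \<open>dec\<close>
    likewise falls back to 0 on strings that encode nothing.\<close>
  define enc where "enc y = (if y \<in> {-M..M} then f y else [])" for y
  define dec where "dec m = (if m \<in> f ` {-M..M} then inv_into {-M..M} f m else 0)" for m
  have 1: "length (enc y) \<le> b" for y
    using f(1) by (auto simp: enc_def image_subset_iff)
  have 2: "\<bar>dec m\<bar> \<le> M" for m
  proof (cases "m \<in> f ` {-M..M}")
    case True
    then have "dec m \<in> {-M..M}" unfolding dec_def by (simp add: inv_into_into del: atLeastAtMost_iff)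
    then show ?thesis by auto
  qed (use assms in \<open>simp add: dec_def\<close>)
  have 3: "dec (enc y) = y" if "\<bar>y\<bar> \<le> M" for y
  proof -
    have "y \<in> {-M..M}" using that by auto
    then show ?thesis using f(2) by (simp add: enc_def dec_def)
  qed
  have "is_codec b M (enc, dec)"
    unfolding is_codec_def fst_conv snd_conv using 1 2 3 by blast
  then show ?thesis ..
qed

text \<open>Probability that, with \<open>c\<close> bad samples so far and \<open>r\<close> more to come, each of them bad with
  probability \<open>q\<close>, more than half of \<open>K\<close> samples are bad.\<close>

primrec majority_prob :: "real \<Rightarrow> nat \<Rightarrow> nat \<Rightarrow> nat \<Rightarrow> real" where
  "majority_prob q K 0 c = (if K < 2 * c then 1 else 0)"
| "majority_prob q K (Suc r) c =
     (1 - q) * majority_prob q K r c + q * majority_prob q K r (Suc c)"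

lemma majority_prob_nonneg: "0 \<le> q \<Longrightarrow> q \<le> 1 \<Longrightarrow> 0 \<le> majority_prob q K r c"
  by (induction r arbitrary: c) auto

text \<open>Makes a bad sample the worse outcome, so that an upper bound on its probability
  suffices.\<close>

lemma majority_prob_mono:
  "0 \<le> q \<Longrightarrow> q \<le> 1 \<Longrightarrow> majority_prob q K r c \<le> majority_prob q K r (Suc c)"
  by (induction r arbitrary: c) (auto intro!: add_mono mult_left_mono)

lemma majority_prob_3: "majority_prob q 3 3 0 = 3 * q ^ 2 - 2 * q ^ 3"
  by (simp add: numeral_3_eq_3 power2_eq_square algebra_simps)

text \<open>A union bound: \<open>k + 1 - c\<close> of the remaining \<open>r\<close> samples must
  be bad, and there are at most \<open>2 ^ r\<close> sets of positions for them.\<close>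

lemma majority_prob_le:
  assumes "0 \<le> q" "q \<le> 1"
  shows "majority_prob q (2 * k + 1) r c \<le> 2 ^ r * q ^ (k + 1 - c)"
proof (induction r arbitrary: c)
  case 0
  then show ?case using assms by auto
next
  case (Suc r)
  have "majority_prob q (2 * k + 1) (Suc r) c
      \<le> (1 - q) * (2 ^ r * q ^ (k + 1 - c)) + q * (2 ^ r * q ^ (k + 1 - Suc c))"
    unfolding majority_prob.simps by (intro add_mono mult_left_mono Suc.IH) (use assms in auto)
  also have "\<dots> \<le> 2 ^ Suc r * q ^ (k + 1 - c)"
  proof (cases "c \<le> k")
    case True
    then have "k + 1 - c = Suc (k + 1 - Suc c)" by simp
    then have e: "q ^ (k + 1 - c) = q * q ^ (k + 1 - Suc c)" by (metis power_Suc)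
    have "(1 - q) * (2 ^ r * q ^ (k + 1 - c)) + q * (2 ^ r * q ^ (k + 1 - Suc c))
        = (2 - q) * (2 ^ r * q ^ (k + 1 - c))"
      unfolding e by (simp add: algebra_simps)
    also have "\<dots> \<le> 2 * (2 ^ r * q ^ (k + 1 - c))"
      using assms by (intro mult_right_mono) auto
    finally show ?thesis by simp
  qed (simp add: algebra_simps)
  finally show ?case .
qed

subsection \<open>One phase against the adversary\<close>

text \<open>The first \<open>s\<close> entries are the most recent ones: the samples of the current
  phase after \<open>s\<close> of its rounds.\<close>

definition bad_count :: "(int \<Rightarrow> bool) \<Rightarrow> nat \<Rightarrow> nat \<Rightarrow> nat" where
  "bad_count P s \<sigma>v = length (filter P (take s (samples \<sigma>v)))"

text \<open>Unlike \<open>execution\<close>, this unfolds the earliest round first and starts from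
  any state, as backward induction over a phase requires.\<close>

primrec rounds ::
  "nat \<Rightarrow> 's gossip_algorithm \<Rightarrow> 's adversary \<Rightarrow> nat \<Rightarrow> (nat \<Rightarrow> 's) \<times> 's history
     \<Rightarrow> ((nat \<Rightarrow> 's) \<times> 's history) pmf" where
  "rounds n A adv 0 st = return_pmf st"
| "rounds n A adv (Suc r) st = bind_pmf (gossip_round n A adv st) (rounds n A adv r)"

lemma rounds_Suc_right:
  "rounds n A adv (Suc r) st = bind_pmf (rounds n A adv r st) (gossip_round n A adv)"
proof (induction r arbitrary: st)
  case 0
  have "rounds n A adv 0 = return_pmf" by (rule ext) simp
  then show ?case by (simp add: bind_return_pmf bind_return_pmf')
next
  case (Suc r)
  have "rounds n A adv (Suc (Suc r)) st
      = bind_pmf (gossip_round n A adv st) (rounds n A adv (Suc r))"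
    by (rule rounds.simps)
  also have "\<dots> = bind_pmf (gossip_round n A adv st)
      (\<lambda>st'. bind_pmf (rounds n A adv r st') (gossip_round n A adv))"
    by (rule bind_pmf_cong[OF refl Suc.IH])
  finally show ?case by (simp only: bind_assoc_pmf[symmetric] rounds.simps)
qed

lemma execution_add:
  "execution n A adv x (t + r) = bind_pmf (execution n A adv x t) (rounds n A adv r)"
proof (induction r)
  case 0
  have "rounds n A adv 0 = return_pmf" by (rule ext) simp
  then show ?case by (simp add: bind_return_pmf')
next
  case (Suc r)
  show ?case
    by (simp only: add_Suc_right execution.simps Suc.IH bind_assoc_pmf rounds_Suc_right)
qed

lemma power_card_le_prod:
  fixes a :: real
  assumes "finite A" "0 \<le> a" "\<And>v. v \<in> A \<Longrightarrow> Q v \<Longrightarrow> R v"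
  shows "(1 + a) ^ card {v \<in> A. Q v} \<le> (\<Prod>v\<in>A. 1 + a * (if R v then 1 else 0))"
proof -
  have "(1 + a) ^ card {v \<in> A. Q v} = (\<Prod>v\<in>A. if Q v then 1 + a else 1)"
    using assms(1) by (simp add: prod.If_cases Int_def)
  also have "\<dots> \<le> (\<Prod>v\<in>A. 1 + a * (if R v then 1 else 0))"
    using assms by (intro prod_mono) auto
  finally show ?thesis .
qed

section \<open>Reachable states and the law of one round\<close>

locale median_gossip =
  fixes n :: nat and enc :: "int \<Rightarrow> message" and dec :: "message \<Rightarrow> int" and M :: int
    and ph :: "nat \<Rightarrow> nat" and x :: "nat \<Rightarrow> int" and adv :: "nat adversary" and \<beta> :: real
  assumes n_pos: "n > 0"
    and dec_range: "\<And>m. \<bar>dec m\<bar> \<le> M"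
    and dec_enc: "\<And>y. \<bar>y\<bar> \<le> M \<Longrightarrow> dec (enc y) = y"
    and x_range: "\<And>v. v < n \<Longrightarrow> \<bar>x v\<bar> \<le> M"
    and adv: "strong_adversary n \<beta> adv"
begin

abbreviation "A \<equiv> median_algorithm enc dec ph"

definition valid :: "nat \<Rightarrow> (nat \<Rightarrow> nat) \<Rightarrow> bool" where
  "valid t \<sigma> \<longleftrightarrow> (\<forall>v<n. own (\<sigma> v) = x v \<and> length (samples (\<sigma> v)) = t \<and>
     (\<forall>z \<in> set (samples (\<sigma> v)). \<bar>z\<bar> \<le> M))"

definition bad :: "(int \<Rightarrow> bool) \<Rightarrow> (nat \<Rightarrow> nat) \<Rightarrow> nat set" where
  "bad P \<sigma> = {v. v < n \<and> P (estimate ph (\<sigma> v))}"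

lemma estimate_range: "valid t \<sigma> \<Longrightarrow> v < n \<Longrightarrow> \<bar>estimate ph (\<sigma> v)\<bar> \<le> M"
  unfolding estimate_def by (rule current_range) (auto simp: valid_def x_range)

text \<open>With trivial coin tosses the product distribution collapses to a point: the old states,
  with \<open>undefined\<close> outside \<open>{..<n}\<close>, the default value of
  \<open>Pi_pmf\<close>.\<close>

lemma round_eq:
  "gossip_round n A adv (\<sigma>0, h) =
     (let \<sigma> = (\<lambda>v. if v < n then \<sigma>0 v else undefined) in
     bind_pmf (attack adv h \<sigma>) (\<lambda>B.
     bind_pmf (random_partners n) (\<lambda>p.
     bind_pmf (forge adv h \<sigma> B p) (\<lambda>f.
     return_pmf (next_states n A \<sigma> B p f, (\<sigma>, B, p, f) # h)))))"
  by (simp add: gossip_round_def median_algorithm_def bind_return_pmf Let_def)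

lemma partners: "p \<in> set_pmf (random_partners n) \<Longrightarrow> v < n \<Longrightarrow> p v < n"
  using n_pos by (auto simp: random_partners_def set_Pi_pmf PiE_dflt_def lessThan_empty_iff)

lemma next_state:
  fixes \<sigma>0 :: "nat \<Rightarrow> nat"
  defines "\<sigma> \<equiv> (\<lambda>v. if v < n then \<sigma>0 v else undefined)"
  assumes "valid t \<sigma>0" "v < n" "p v < n"
  shows "next_states n A \<sigma> B p f v =
    to_nat (x v, (if p v \<in> B then dec (f v) else estimate ph (\<sigma>0 (p v))) # samples (\<sigma>0 v))"
  using assms estimate_range[OF assms(2), of "p v"]
  by (auto simp: next_states_def median_algorithm_def pull_answer_def transmitted_def valid_def
      dec_enc)

lemma round_support:
  assumes "valid t \<sigma>0" "(\<sigma>', h') \<in> set_pmf (gossip_round n A adv (\<sigma>0, h))"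
  shows "valid (Suc t) \<sigma>'"
    and "v < n \<Longrightarrow> own (\<sigma>' v) = own (\<sigma>0 v) \<and> tl (samples (\<sigma>' v)) = samples (\<sigma>0 v)"
proof -
  define \<sigma> where "\<sigma> = (\<lambda>v. if v < n then \<sigma>0 v else undefined)"
  obtain B p f where p: "p \<in> set_pmf (random_partners n)"
    and s: "\<sigma>' = next_states n A \<sigma> B p f"
    using assms(2) unfolding round_eq by (auto simp: \<sigma>_def Let_def)
  have *: "\<sigma>' v =
    to_nat (x v, (if p v \<in> B then dec (f v) else estimate ph (\<sigma>0 (p v))) # samples (\<sigma>0 v))"
    if "v < n" for v
    unfolding s \<sigma>_def using next_state[where p = p and B = B and f = f, OF assms(1) that partners[OF p that]] .
  show "valid (Suc t) \<sigma>'"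
    using assms(1) partners[OF p] estimate_range[OF assms(1)] dec_range
    by (auto simp: valid_def *)
  show "own (\<sigma>' v) = own (\<sigma>0 v) \<and> tl (samples (\<sigma>' v)) = samples (\<sigma>0 v)" if "v < n"
    using assms(1) that by (auto simp: valid_def *)
qed

lemma execution_valid: "(\<sigma>, h) \<in> set_pmf (execution n A adv x t) \<Longrightarrow> valid t \<sigma>"
proof (induction t arbitrary: \<sigma> h)
  case 0
  then show ?case by (simp add: valid_def median_algorithm_def)
next
  case (Suc t)
  then show ?case using round_support(1) by fastforce
qed

text \<open>The mean equals \<open>a + (b - a) * card D / n\<close>, which is increasing in
  \<open>card D\<close> because \<open>a \<le> b\<close>.\<close>

lemma partner_average:
  assumes "0 \<le> a" "a \<le> b" "D \<subseteq> {..<n}" "real (card D) \<le> q * real n"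
  shows "(\<integral>\<^sup>+u. ennreal (if u \<in> D then b else a) \<partial>measure_pmf (pmf_of_set {..<n}))
    \<le> ennreal ((1 - q) * a + q * b)"
proof -
  have fin: "finite D" using assms(3) finite_subset by blast
  have "(\<integral>\<^sup>+u. ennreal (if u \<in> D then b else a) \<partial>measure_pmf (pmf_of_set {..<n}))
      = (\<Sum>u<n. ennreal (if u \<in> D then b else a)) / ennreal (real n)"
    using n_pos by (subst nn_integral_pmf_of_set) (auto simp: ennreal_of_nat_eq_real_of_nat)
  also have "\<dots> = ennreal ((\<Sum>u<n. if u \<in> D then b else a) / real n)"
    using assms n_pos by (subst sum_ennreal) (auto intro!: divide_ennreal sum_nonneg)
  also have "(\<Sum>u<n. if u \<in> D then b else a) = (\<Sum>u<n. a + (if u \<in> D then b - a else 0))"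
    by (intro sum.cong) auto
  also have "\<dots> = real n * a + real (card D) * (b - a)"
    using assms(3) by (simp add: sum.distrib sum.If_cases Int_absorb1)
  also have "(real n * a + real (card D) * (b - a)) / real n \<le> (1 - q) * a + q * b"
  proof -
    have "real (card D) * (b - a) \<le> q * real n * (b - a)"
      using assms by (intro mult_right_mono) auto
    then show ?thesis using n_pos by (simp add: field_simps)
  qed
  finally show ?thesis by (simp add: ennreal_leI)
qed

text \<open>The attacked set is fixed before the partners are drawn, so given the past each sample
  is bad with probability at most \<open>q\<close>, and independent partners make the bound a
  product.\<close>

lemma round_expectation:
  assumes val: "valid t \<sigma>0"
    and q: "real (card (bad P \<sigma>0)) + \<beta> * real n \<le> q * real n"
    and g: "\<And>c. 0 \<le> g c" "\<And>c. g c \<le> g (Suc c)"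
  shows "(\<integral>\<^sup>+st. ennreal (\<Prod>v<n. g (bad_count P (Suc s) (fst st v)))
            \<partial>measure_pmf (gossip_round n A adv (\<sigma>0, h)))
    \<le> ennreal (\<Prod>v<n. (1 - q) * g (bad_count P s (\<sigma>0 v)) + q * g (Suc (bad_count P s (\<sigma>0 v))))"
proof -
  define \<sigma> where "\<sigma> = (\<lambda>v. if v < n then \<sigma>0 v else undefined)"
  define c where "c v = bad_count P s (\<sigma>0 v)" for v
  \<comment> \<open>Counting every contact with an attacked or bad node as a bad sample removes the
    dependence on the forged messages, which may depend on all partners at once.\<close>
  define W where "W B v u = (if u \<in> B \<union> bad P \<sigma>0 then g (Suc (c v)) else g (c v))" for B v u
  have W0: "0 \<le> W B v u" for B v u by (simp add: W_def g)
  have next_le: "g (bad_count P (Suc s) (next_states n A \<sigma> B p f v)) \<le> W B v (p v)"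
    if "p \<in> set_pmf (random_partners n)" "v < n" for B p f v
    unfolding \<sigma>_def
    using next_state[where p = p and B = B and f = f, OF val that(2) partners[OF that]] partners[OF that] g(2)[of "c v"]
    by (auto simp: bad_count_def W_def c_def bad_def)
  have avg: "(\<integral>\<^sup>+p. ennreal (\<Prod>v<n. W B v (p v)) \<partial>measure_pmf (random_partners n))
      \<le> ennreal (\<Prod>v<n. (1 - q) * g (c v) + q * g (Suc (c v)))"
    if B: "B \<in> set_pmf (attack adv h \<sigma>)" for B
  proof -
    have Bn: "B \<subseteq> {..<n}" "real (card B) \<le> \<beta> * real n"
      using adv B by (auto simp: strong_adversary_def)
    have D: "B \<union> bad P \<sigma>0 \<subseteq> {..<n}" using Bn by (auto simp: bad_def)
    have "card (B \<union> bad P \<sigma>0) \<le> card B + card (bad P \<sigma>0)" by (rule card_Un_le)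
    then have Dq: "real (card (B \<union> bad P \<sigma>0)) \<le> q * real n" using q Bn by linarith
    have q0: "0 \<le> q" using Dq n_pos
      by (smt (verit) mult_neg_pos of_nat_0_le_iff of_nat_0_less_iff)
    have "(\<integral>\<^sup>+p. ennreal (\<Prod>v<n. W B v (p v)) \<partial>measure_pmf (random_partners n))
        = (\<integral>\<^sup>+p. (\<Prod>v<n. ennreal (W B v (p v))) \<partial>measure_pmf (random_partners n))"
      by (simp add: prod_ennreal W0)
    \<comment> \<open>Independence of the partners: each factor depends on the partner of one node
      only.\<close>
    also have "\<dots> = (\<Prod>v<n. \<integral>\<^sup>+u. ennreal (W B v u) \<partial>measure_pmf (pmf_of_set {..<n}))"
      unfolding random_partners_def by (rule nn_integral_prod_Pi_pmf) simp
    also have "\<dots> \<le> (\<Prod>v<n. ennreal ((1 - q) * g (c v) + q * g (Suc (c v))))"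
      unfolding W_def by (intro prod_mono_ennreal partner_average g D Dq)
    also have "\<dots> = ennreal (\<Prod>v<n. (1 - q) * g (c v) + q * g (Suc (c v)))"
    proof (rule prod_ennreal)
      fix v
      have "0 \<le> g (c v) + q * (g (Suc (c v)) - g (c v))"
        using g q0 by (intro add_nonneg_nonneg mult_nonneg_nonneg) auto
      then show "0 \<le> (1 - q) * g (c v) + q * g (Suc (c v))" by (simp add: algebra_simps)
    qed
    finally show ?thesis .
  qed
  have "(\<integral>\<^sup>+st. ennreal (\<Prod>v<n. g (bad_count P (Suc s) (fst st v)))
            \<partial>measure_pmf (gossip_round n A adv (\<sigma>0, h)))
      = (\<integral>\<^sup>+B. \<integral>\<^sup>+p. \<integral>\<^sup>+f. ennreal (\<Prod>v<n. g (bad_count P (Suc s) (next_states n A \<sigma> B p f v)))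
          \<partial>measure_pmf (forge adv h \<sigma> B p) \<partial>measure_pmf (random_partners n)
          \<partial>measure_pmf (attack adv h \<sigma>))"
    unfolding round_eq by (simp add: Let_def \<sigma>_def)
  also have "\<dots> \<le> (\<integral>\<^sup>+B. \<integral>\<^sup>+p. \<integral>\<^sup>+f. ennreal (\<Prod>v<n. W B v (p v))
          \<partial>measure_pmf (forge adv h \<sigma> B p) \<partial>measure_pmf (random_partners n)
          \<partial>measure_pmf (attack adv h \<sigma>))"
    by (intro nn_integral_mono_AE AE_pmfI nn_integral_mono ennreal_leI prod_mono conjI g(1) next_le)
      auto
  also have "\<dots> = (\<integral>\<^sup>+B. \<integral>\<^sup>+p. ennreal (\<Prod>v<n. W B v (p v))
          \<partial>measure_pmf (random_partners n) \<partial>measure_pmf (attack adv h \<sigma>))"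
    by simp
  also have "\<dots> \<le> (\<integral>\<^sup>+B. ennreal (\<Prod>v<n. (1 - q) * g (c v) + q * g (Suc (c v)))
          \<partial>measure_pmf (attack adv h \<sigma>))"
    by (intro nn_integral_mono_AE AE_pmfI avg)
  also have "\<dots> = ennreal (\<Prod>v<n. (1 - q) * g (c v) + q * g (Suc (c v)))"
    by simp
  finally show ?thesis by (simp add: c_def)
qed

section \<open>Exponential moments and tail bounds for a whole phase\<close>

lemma rounds_valid:
  "valid t \<sigma> \<Longrightarrow> (\<sigma>', h') \<in> set_pmf (rounds n A adv r (\<sigma>, h)) \<Longrightarrow> valid (t + r) \<sigma>'"
proof (induction r arbitrary: t \<sigma> h)
  case 0
  then show ?case by simp
next
  case (Suc r)
  from Suc.prems(2) obtain \<sigma>1 h1 where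
    1: "(\<sigma>1, h1) \<in> set_pmf (gossip_round n A adv (\<sigma>, h))"
       "(\<sigma>', h') \<in> set_pmf (rounds n A adv r (\<sigma>1, h1))" by auto
  have "valid (Suc t) \<sigma>1" using round_support(1)[OF Suc.prems(1) 1(1)] .
  from Suc.IH[OF this 1(2)] show ?case by simp
qed

text \<open>Keeps the bad set fixed during a phase, so that one \<open>q\<close> serves all its
  rounds.\<close>

lemma bad_unchanged:
  assumes "valid t \<sigma>" "(\<sigma>', h') \<in> set_pmf (gossip_round n A adv (\<sigma>, h))" "ph (Suc t) = 0"
  shows "bad P \<sigma>' = bad P \<sigma>"
proof -
  have "estimate ph (\<sigma>' v) = estimate ph (\<sigma> v)" if v: "v < n" for v
  proof -
    note r = round_support(2)[OF assms(1,2) v]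
    have "length (samples (\<sigma>' v)) = Suc t" "length (samples (\<sigma> v)) = t"
      using round_support(1)[OF assms(1,2)] assms(1) v by (auto simp: valid_def)
    then obtain z where "samples (\<sigma>' v) = z # samples (\<sigma> v)"
      using r by (metis length_Suc_conv list.sel(3))
    then show ?thesis
      using r \<open>length (samples (\<sigma> v)) = t\<close> assms(3) by (simp add: estimate_def)
  qed
  then show ?thesis by (auto simp: bad_def)
qed

text \<open>The supermartingale property, by induction on the number \<open>r\<close> of remaining
  rounds. The bound on the bad nodes is demanded only while \<open>r > 0\<close>, since the last
  round of a phase replaces the estimates.\<close>

lemma rounds_expectation:
  assumes q: "0 \<le> q" "q \<le> 1" and a: "0 \<le> a"
    and ph: "\<And>i. 0 < i \<Longrightarrow> i < K \<Longrightarrow> ph (t + i) = 0"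
    and "r + s = K" "valid (t + s) \<sigma>"
    and "r > 0 \<Longrightarrow> real (card (bad P \<sigma>)) + \<beta> * real n \<le> q * real n"
  shows "(\<integral>\<^sup>+st. ennreal (\<Prod>v<n. 1 + a * majority_prob q K 0 (bad_count P K (fst st v)))
            \<partial>measure_pmf (rounds n A adv r (\<sigma>, h)))
    \<le> ennreal (\<Prod>v<n. 1 + a * majority_prob q K r (bad_count P s (\<sigma> v)))"
  using assms(5-)
proof (induction r arbitrary: s \<sigma> h)
  case 0
  then show ?case by simp
next
  case (Suc r)
  define g where "g c = 1 + a * majority_prob q K r c" for c
  have IH: "(\<integral>\<^sup>+st. ennreal (\<Prod>v<n. 1 + a * majority_prob q K 0 (bad_count P K (fst st v)))
            \<partial>measure_pmf (rounds n A adv r st1))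
     \<le> ennreal (\<Prod>v<n. g (bad_count P (Suc s) (fst st1 v)))"
    if "st1 \<in> set_pmf (gossip_round n A adv (\<sigma>, h))" for st1
  proof -
    obtain \<sigma>1 h1 where st1: "st1 = (\<sigma>1, h1)" by (cases st1)
    note 1 = that[unfolded st1]
    have "valid (t + Suc s) \<sigma>1" using round_support(1)[OF Suc.prems(2) 1] by simp
    moreover have "bad P \<sigma>1 = bad P \<sigma>" if "r > 0"
      using bad_unchanged[OF Suc.prems(2) 1] ph[of "Suc s"] that Suc.prems(1) by simp
    ultimately have "(\<integral>\<^sup>+st. ennreal (\<Prod>v<n. 1 + a * majority_prob q K 0 (bad_count P K (fst st v)))
            \<partial>measure_pmf (rounds n A adv r (\<sigma>1, h1)))
        \<le> ennreal (\<Prod>v<n. 1 + a * majority_prob q K r (bad_count P (Suc s) (\<sigma>1 v)))"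
      using Suc.prems by (intro Suc.IH) auto
    then show ?thesis by (simp add: st1 g_def)
  qed
  have "(\<integral>\<^sup>+st. ennreal (\<Prod>v<n. 1 + a * majority_prob q K 0 (bad_count P K (fst st v)))
            \<partial>measure_pmf (rounds n A adv (Suc r) (\<sigma>, h)))
    \<le> (\<integral>\<^sup>+st1. ennreal (\<Prod>v<n. g (bad_count P (Suc s) (fst st1 v)))
          \<partial>measure_pmf (gossip_round n A adv (\<sigma>, h)))"
    unfolding rounds.simps nn_integral_bind_pmf by (intro nn_integral_mono_AE AE_pmfI IH)
  also have "\<dots> \<le> ennreal (\<Prod>v<n. (1 - q) * g (bad_count P s (\<sigma> v))
                                + q * g (Suc (bad_count P s (\<sigma> v))))"
  proof (rule round_expectation)
    show "0 \<le> g c" "g c \<le> g (Suc c)" for c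
      using q a by (auto simp: g_def majority_prob_nonneg intro!: mult_left_mono majority_prob_mono)
  qed (use Suc.prems in auto)
  \<comment> \<open>This is the recursion for \<open>majority_prob\<close>; the summand 1 survives
    because the weights \<open>1 - q\<close> and \<open>q\<close> add up to 1.\<close>
  also have "(\<lambda>c. (1 - q) * g c + q * g (Suc c)) = (\<lambda>c. 1 + a * majority_prob q K (Suc r) c)"
    by (rule ext) (simp add: g_def algebra_simps)
  then have "(\<Prod>v<n. (1 - q) * g (bad_count P s (\<sigma> v)) + q * g (Suc (bad_count P s (\<sigma> v))))
      = (\<Prod>v<n. 1 + a * majority_prob q K (Suc r) (bad_count P s (\<sigma> v)))"
    by (intro prod.cong refl) metis
  finally show ?case .
qed

text \<open>With no sample left, \<open>majority_prob\<close> is the indicator of a bad majority,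
  which dominates badness of the new median; at the start of the phase every count is 0.\<close>

lemma phase_expectation:
  assumes q: "0 \<le> q" "q \<le> 1" and a: "0 \<le> a" and K: "odd K" and P: "majority_closed P"
    and ph: "\<And>i. 0 < i \<Longrightarrow> i < K \<Longrightarrow> ph (t + i) = 0" "ph (t + K) = K"
    and val: "valid t \<sigma>"
    and bad: "real (card (bad P \<sigma>)) + \<beta> * real n \<le> q * real n"
  shows "(\<integral>\<^sup>+st. ennreal ((1 + a) ^ card (bad P (fst st))) \<partial>measure_pmf (rounds n A adv K (\<sigma>, h)))
    \<le> ennreal ((1 + a * majority_prob q K K 0) ^ n)"
proof -
  have K0: "K > 0" using K by (auto elim: oddE)
  have "(1 + a) ^ card (bad P (fst st))
      \<le> (\<Prod>v<n. 1 + a * majority_prob q K 0 (bad_count P K (fst st v)))"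
    if "st \<in> set_pmf (rounds n A adv K (\<sigma>, h))" for st
  proof -
    have v: "valid (t + K) (fst st)"
      using rounds_valid[OF val, of "fst st" "snd st"] that by simp
    have "K < 2 * bad_count P K (fst st v)" if "v < n" "P (estimate ph (fst st v))" for v
    proof -
      have len: "length (samples (fst st v)) = t + K" using v that by (auto simp: valid_def)
      then obtain z zs where zs: "samples (fst st v) = z # zs" using K0
        by (cases "samples (fst st v)") auto
      with len have "Suc (length zs) = t + K" by simp
      then have "estimate ph (fst st v) = median (take K (samples (fst st v)))"
        using ph(2) K0 by (simp add: estimate_def zs)
      then show ?thesis
        using P that len K unfolding majority_closed_def bad_count_def
        by (metis length_take min.absorb2 le_add2)
    qed
    then have "(1 + a) ^ card {v \<in> {..<n}. P (estimate ph (fst st v))}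
      \<le> (\<Prod>v<n. 1 + a * (if K < 2 * bad_count P K (fst st v) then 1 else 0))"
      using a by (intro power_card_le_prod) auto
    then show ?thesis by (simp add: bad_def)
  qed
  then have "(\<integral>\<^sup>+st. ennreal ((1 + a) ^ card (bad P (fst st))) \<partial>measure_pmf (rounds n A adv K (\<sigma>, h)))
    \<le> (\<integral>\<^sup>+st. ennreal (\<Prod>v<n. 1 + a * majority_prob q K 0 (bad_count P K (fst st v)))
            \<partial>measure_pmf (rounds n A adv K (\<sigma>, h)))"
    by (intro nn_integral_mono_AE AE_pmfI ennreal_leI) auto
  also have "\<dots> \<le> ennreal (\<Prod>v<n. 1 + a * majority_prob q K K (bad_count P 0 (\<sigma> v)))"
    using val bad by (intro rounds_expectation[where t = t] q a ph) auto
  finally show ?thesis by (simp add: bad_count_def)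
qed

text \<open>Left open here is the choice of \<open>a\<close>: proportional to the deviation \<open>\<eta>\<close>, it gives a Chernoff
  bound; of order \<open>1 / n\<close>, it gives Markov's inequality.\<close>

lemma phase_tail:
  assumes q: "0 \<le> q" "q \<le> 1" and a: "0 \<le> a" and K: "odd K" and P: "majority_closed P"
    and ph: "\<And>i. 0 < i \<Longrightarrow> i < K \<Longrightarrow> ph (t + i) = 0" "ph (t + K) = K"
    and p: "p + \<beta> \<le> q"
    and w: "w > 0" "\<And>X. y * real n < real X \<Longrightarrow> w \<le> (1 + a) ^ X"
    and \<delta>: "(1 + a * majority_prob q K K 0) ^ n / w \<le> \<delta>"
  shows "measure_pmf.prob (execution n A adv x (t + K)) {st. y * real n < card (bad P (fst st))}
    \<le> measure_pmf.prob (execution n A adv x t) {st. p * real n < card (bad P (fst st))} + \<delta>"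
proof -
  define S where "S = {st :: (nat \<Rightarrow> nat) \<times> nat history. y * real n < card (bad P (fst st))}"
  define S0 where "S0 = {st :: (nat \<Rightarrow> nat) \<times> nat history. p * real n < card (bad P (fst st))}"
  have \<delta>0: "0 \<le> \<delta>"
    using \<delta> a w(1) majority_prob_nonneg[OF q, of K K 0]
    by (smt (verit) divide_nonneg_pos mult_nonneg_nonneg zero_le_power)
  \<comment> \<open>Markov's inequality for the exponential moment, with threshold
    \<open>w\<close>.\<close>
  have phase: "emeasure (measure_pmf (rounds n A adv K (\<sigma>, h))) S \<le> ennreal \<delta>"
    if val: "valid t \<sigma>" and good: "(\<sigma>, h) \<notin> S0" for \<sigma> h
  proof -
    have "real (card (bad P \<sigma>)) \<le> p * real n" using good by (simp add: S0_def)
    moreover have "(p + \<beta>) * real n \<le> q * real n" using p by (intro mult_right_mono) auto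
    ultimately have bad: "real (card (bad P \<sigma>)) + \<beta> * real n \<le> q * real n"
      by (simp add: algebra_simps)
    have "emeasure (measure_pmf (rounds n A adv K (\<sigma>, h))) S
        = (\<integral>\<^sup>+st. indicator S st \<partial>measure_pmf (rounds n A adv K (\<sigma>, h)))" by simp
    also have "\<dots> \<le> (\<integral>\<^sup>+st. ennreal (1 / w) * ennreal ((1 + a) ^ card (bad P (fst st)))
        \<partial>measure_pmf (rounds n A adv K (\<sigma>, h)))"
    proof (intro nn_integral_mono)
      fix st
      show "indicator S st \<le> ennreal (1 / w) * ennreal ((1 + a) ^ card (bad P (fst st)))"
      proof (cases "st \<in> S")
        case True
        then have "1 \<le> 1 / w * (1 + a) ^ card (bad P (fst st))"
          using w by (simp add: S_def field_simps)
        then have "ennreal 1 \<le> ennreal (1 / w * (1 + a) ^ card (bad P (fst st)))"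
          by (rule ennreal_leI)
        also have "\<dots> = ennreal (1 / w) * ennreal ((1 + a) ^ card (bad P (fst st)))"
          using w(1) a by (intro ennreal_mult) auto
        finally show ?thesis using True by simp
      qed simp
    qed
    also have "\<dots> = ennreal (1 / w) * (\<integral>\<^sup>+st. ennreal ((1 + a) ^ card (bad P (fst st)))
        \<partial>measure_pmf (rounds n A adv K (\<sigma>, h)))"
      by (rule nn_integral_cmult) simp
    also have "\<dots> \<le> ennreal (1 / w) * ennreal ((1 + a * majority_prob q K K 0) ^ n)"
      by (intro mult_left_mono phase_expectation[where t = t] q a K P ph val bad) auto
    also have "\<dots> = ennreal ((1 + a * majority_prob q K K 0) ^ n / w)"
      using w(1) a majority_prob_nonneg[OF q, of K K 0] by (simp add: ennreal_mult[symmetric])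
    also have "\<dots> \<le> ennreal \<delta>" using \<delta> by (rule ennreal_leI)
    finally show ?thesis .
  qed
  have "emeasure (measure_pmf (execution n A adv x (t + K))) S
      = (\<integral>\<^sup>+st. emeasure (measure_pmf (rounds n A adv K st)) S \<partial>measure_pmf (execution n A adv x t))"
    by (simp add: execution_add)
  \<comment> \<open>A phase with a bad start is charged probability 1, any other one at most
    \<open>\<delta>\<close>.\<close>
  also have "\<dots> \<le> (\<integral>\<^sup>+st. indicator S0 st + ennreal \<delta> \<partial>measure_pmf (execution n A adv x t))"
  proof (intro nn_integral_mono_AE AE_pmfI)
    fix st assume st: "st \<in> set_pmf (execution n A adv x t)"
    obtain \<sigma> h where sh: "st = (\<sigma>, h)" by (cases st)
    have "emeasure (measure_pmf (rounds n A adv K st)) S \<le> 1"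
      by (rule measure_pmf.subprob_emeasure_le_1)
    then show "emeasure (measure_pmf (rounds n A adv K st)) S \<le> indicator S0 st + ennreal \<delta>"
      using phase[of \<sigma> h] execution_valid[OF st[unfolded sh]] sh
      by (cases "st \<in> S0") (auto intro: order_trans)
  qed
  also have "\<dots> = emeasure (measure_pmf (execution n A adv x t)) S0 + ennreal \<delta>"
    by (subst nn_integral_add) auto
  finally have "ennreal (measure_pmf.prob (execution n A adv x (t + K)) S)
      \<le> ennreal (measure_pmf.prob (execution n A adv x t) S0 + \<delta>)"
    using \<delta>0 by (simp add: measure_pmf.emeasure_eq_measure)
  then show ?thesis
    using \<delta>0 unfolding S_def S0_def by (subst (asm) ennreal_le_iff) auto
qed

lemma phase_concentration:
  assumes q: "0 \<le> q" "q \<le> 1" and K: "odd K" and P: "majority_closed P"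
    and ph: "\<And>i. 0 < i \<Longrightarrow> i < K \<Longrightarrow> ph (t + i) = 0" "ph (t + K) = K"
    and p: "p + \<beta> \<le> q"
    and \<eta>: "0 \<le> \<eta>" "majority_prob q K K 0 + \<eta> \<le> y" "y \<le> 1"
  shows "measure_pmf.prob (execution n A adv x (t + K)) {st. y * real n < card (bad P (fst st))}
    \<le> measure_pmf.prob (execution n A adv x t) {st. p * real n < card (bad P (fst st))}
       + exp (- real n * \<eta>\<^sup>2 / 4)"
proof -
  define f where "f = majority_prob q K K 0"
  \<comment> \<open>This choice minimises \<open>a\<^sup>2 - a * \<eta>\<close>, the exponent per
    node that is reached below.\<close>
  define a where "a = \<eta> / 2"
  have f0: "0 \<le> f" unfolding f_def by (rule majority_prob_nonneg[OF q])
  have a: "0 \<le> a" "a \<le> 1" using \<eta> f0 by (auto simp: a_def f_def)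
  define w where "w = exp ((a - a\<^sup>2) * (y * real n))"
  have ln: "a - a\<^sup>2 \<le> ln (1 + a)" using ln_one_plus_pos_lower_bound[OF a] .
  have aa: "0 \<le> a - a\<^sup>2" using a by (simp add: power2_eq_square mult_left_le)
  have w: "w \<le> (1 + a) ^ X" if "y * real n < real X" for X
  proof -
    have "(a - a\<^sup>2) * (y * real n) \<le> ln (1 + a) * real X"
      using that ln aa by (intro mult_mono) (use \<eta> f0 f_def in auto)
    then have "w \<le> exp (ln (1 + a) * real X)" by (simp add: w_def)
    also have "\<dots> = (1 + a) ^ X" using a by (simp add: exp_of_nat2_mult)
    finally show ?thesis .
  qed
  have "(1 + a * f) ^ n \<le> exp (a * f) ^ n"
    using a f0 by (intro power_mono) (auto simp: exp_ge_add_one_self)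
  then have "(1 + a * f) ^ n / w \<le> exp (real n * (a * f)) / w"
    by (simp add: w_def exp_of_nat_mult divide_right_mono)
  also have "\<dots> = exp (real n * (a * f - (a - a\<^sup>2) * y))"
    by (simp add: w_def exp_diff[symmetric] algebra_simps)
  also have "\<dots> \<le> exp (- real n * \<eta>\<^sup>2 / 4)"
  proof -
    have "a * f - (a - a\<^sup>2) * y = a * (f - y) + a\<^sup>2 * y" by (simp add: algebra_simps)
    also have "\<dots> \<le> a * (- \<eta>) + a\<^sup>2 * 1"
      using \<eta> a by (intro add_mono mult_left_mono) (auto simp: f_def)
    also have "\<dots> = - \<eta>\<^sup>2 / 4" by (simp add: a_def power2_eq_square)
    finally have "real n * (a * f - (a - a\<^sup>2) * y) \<le> real n * (- \<eta>\<^sup>2 / 4)"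
      by (intro mult_left_mono) auto
    then show ?thesis by simp
  qed
  finally show ?thesis
    using w unfolding f_def
    by (intro phase_tail[OF q a(1) K P ph p, where w = w]) (auto simp: w_def)
qed

lemma phase_markov:
  assumes q: "0 \<le> q" "q \<le> 1" and K: "odd K" and P: "majority_closed P"
    and ph: "\<And>i. 0 < i \<Longrightarrow> i < K \<Longrightarrow> ph (t + i) = 0" "ph (t + K) = K"
    and p: "p + \<beta> \<le> q"
    and f: "majority_prob q K K 0 \<le> f" "0 < f" "0 < y"
  shows "measure_pmf.prob (execution n A adv x (t + K)) {st. y * real n < card (bad P (fst st))}
    \<le> measure_pmf.prob (execution n A adv x t) {st. p * real n < card (bad P (fst st))}
       + exp 1 * f / y"
proof -
  \<comment> \<open>The moment is then at most \<open>exp 1\<close>, while Bernoulli's inequality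
    gives the threshold \<open>y / f\<close>; the price against Markov's inequality for the count
    itself is the factor \<open>exp 1\<close>.\<close>
  define a where "a = 1 / (real n * f)"
  have a: "0 < a" using f n_pos by (simp add: a_def)
  define w where "w = y / f"
  have w: "w \<le> (1 + a) ^ X" if "y * real n < real X" for X
  proof -
    have "w = a * (y * real n)" using n_pos f by (simp add: a_def w_def)
    also have "\<dots> \<le> 1 + real X * a" using that a
      by (smt (verit) mult.commute mult_left_mono)
    also have "\<dots> \<le> (1 + a) ^ X" using a by (intro Bernoulli_inequality) auto
    finally show ?thesis .
  qed
  have "(1 + a * majority_prob q K K 0) ^ n \<le> (1 + a * f) ^ n"
    using a f majority_prob_nonneg[OF q, of K K 0]
    by (intro power_mono add_mono mult_left_mono) (auto intro!: add_nonneg_nonneg)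
  also have "\<dots> \<le> exp (a * f) ^ n"
    using a f by (intro power_mono) (auto simp: exp_ge_add_one_self)
  also have "\<dots> = exp 1"
    using n_pos f by (simp add: a_def exp_of_nat_mult[symmetric])
  finally have "(1 + a * majority_prob q K K 0) ^ n / w \<le> exp 1 * f / y"
    using f by (simp add: w_def field_simps)
  then show ?thesis
    using w a f
    by (intro phase_tail[OF q _ K P ph p, where w = w and a = a]) (auto simp: w_def)
qed

end

subsection \<open>The recursion for the bad fraction\<close>

text \<open>The difference of the two sides has the factor \<open>r - q\<close>, and the cofactor is
  nonnegative on the unit interval.\<close>

lemma majority3_mono:
  fixes q r :: real
  assumes "0 \<le> q" "q \<le> r" "r \<le> 1"
  shows "3 * q\<^sup>2 - 2 * q ^ 3 \<le> 3 * r\<^sup>2 - 2 * r ^ 3"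
proof -
  have "q * q \<le> q" "r * r \<le> r" using assms by (auto intro: mult_left_le)
  moreover have "2 * (q * r) \<le> q * q + r * r"
    using zero_le_power2[of "q - r"] by (simp add: power2_eq_square algebra_simps)
  ultimately have "0 \<le> (r - q) * (3 * (q + r) - 2 * (q * q + q * r + r * r))"
    using assms by (intro mult_nonneg_nonneg) auto
  then show ?thesis by (simp add: power2_eq_square power3_eq_cube algebra_simps)
qed

text \<open>Upper bounds for the bad fraction at the ends of the phases: \<open>\<beta>\<close>
  accounts for attacked contacts, \<open>\<eta>\<close> for random fluctuation.\<close>

primrec tournament :: "real \<Rightarrow> real \<Rightarrow> real \<Rightarrow> nat \<Rightarrow> real" where
  "tournament \<beta> \<eta> p 0 = p"
| "tournament \<beta> \<eta> p (Suc i) =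
     3 * (tournament \<beta> \<eta> p i + \<beta>)\<^sup>2 - 2 * (tournament \<beta> \<eta> p i + \<beta>) ^ 3 + \<eta>"

lemma tournament_add:
  "tournament \<beta> \<eta> p (i + j) = tournament \<beta> \<eta> (tournament \<beta> \<eta> p i) j"
  by (induction j) auto

lemma tournament_step_mono:
  assumes "0 \<le> p" "p \<le> r" "r + \<beta> \<le> s" "s \<le> 1" "0 \<le> \<beta>"
  shows "3 * (p + \<beta>)\<^sup>2 - 2 * (p + \<beta>) ^ 3 + \<eta> \<le> 3 * s\<^sup>2 - 2 * s ^ 3 + (\<eta> :: real)"
  using assms majority3_mono[of "p + \<beta>" s] by auto

lemma tournament_step_nonneg:
  assumes "0 \<le> p" "p + \<beta> \<le> 1" "0 \<le> \<beta>" "0 \<le> \<eta>"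
  shows "0 \<le> 3 * (p + \<beta>)\<^sup>2 - 2 * (p + \<beta>) ^ 3 + (\<eta> :: real)"
  using assms majority3_mono[of 0 "p + \<beta>"] by auto

text \<open>Around the fixed point \<open>1 / 2\<close> the map sends \<open>1 / 2 - d\<close> to
  \<open>1 / 2 - d * (3 / 2 - 2 * d\<^sup>2)\<close>. For \<open>d \<le> 1 / 4\<close> the distance
  grows by a factor of at least \<open>11 / 8\<close>, of which \<open>6 / 5\<close> remains after
  the losses \<open>\<beta>\<close> and \<open>\<eta>\<close>. The \<open>99 / 100\<close> leaves
  room for the rounding term \<open>1 / n\<close> in the initial fraction.\<close>

lemma tournament_growth:
  fixes \<epsilon> \<beta> \<eta> p :: real
  assumes \<epsilon>: "0 < \<epsilon>" and \<beta>: "0 \<le> \<beta>" "\<beta> \<le> \<epsilon> / 14" "\<beta> \<le> 1 / 28"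
    and \<eta>: "0 \<le> \<eta>" "\<eta> \<le> \<epsilon> / 20" and p: "0 \<le> p" "p \<le> 1 / 2 - 99 / 100 * \<epsilon>"
  shows "0 \<le> tournament \<beta> \<eta> p i \<and>
    tournament \<beta> \<eta> p i \<le> 1 / 2 - min (1 / 4) (99 / 100 * \<epsilon> * (6 / 5) ^ i)"
proof (induction i)
  case 0
  then show ?case using p by auto
next
  case (Suc i)
  define e where "e = 99 / 100 * \<epsilon> * (6 / 5) ^ i"
  define d where "d = min (1 / 4) e"
  have "99 / 100 * \<epsilon> * 1 \<le> 99 / 100 * \<epsilon> * (6 / 5) ^ i"
    using \<epsilon> by (intro mult_left_mono one_le_power) auto
  then have e: "99 / 100 * \<epsilon> \<le> e" by (simp add: e_def)
  have IH: "0 \<le> tournament \<beta> \<eta> p i" "tournament \<beta> \<eta> p i \<le> 1 / 2 - d"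
    using Suc by (auto simp: d_def e_def)
  have d0: "0 < d" using e \<epsilon> by (auto simp: d_def)
  have step: "tournament \<beta> \<eta> p (Suc i) \<le> 3 * s\<^sup>2 - 2 * s ^ 3 + \<eta>"
    if "1 / 2 - d + \<beta> \<le> s" "s \<le> 1" for s
    unfolding tournament.simps using IH \<beta> that
    by (intro tournament_step_mono) auto
  have "tournament \<beta> \<eta> p (Suc i) \<le> 1 / 2 - min (1 / 4) (6 / 5 * e)"
  proof (cases "e \<le> 1 / 4")
    case False
    then have "d = 1 / 4" by (simp add: d_def)
    \<comment> \<open>\<open>2 / 7\<close> is \<open>1 / 4 + 1 / 28\<close>.\<close>
    then have "tournament \<beta> \<eta> p (Suc i) \<le> 3 * (2 / 7)\<^sup>2 - 2 * (2 / 7) ^ 3 + \<eta>"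
      using \<beta> by (intro step) auto
    also have "\<dots> \<le> 1 / 4" using \<eta> p by (simp add: power2_eq_square power3_eq_cube)
    finally show ?thesis by auto
  next
    case True
    then have d: "d = e" by (simp add: d_def)
    define d' where "d' = d - \<beta>"
    \<comment> \<open>From \<open>\<beta> \<le> \<epsilon> / 14\<close> and
      \<open>99 / 100 * \<epsilon> \<le> d\<close>; the constant is just below
      \<open>1 - 100 / (14 * 99)\<close>.\<close>
    have d': "d' \<ge> 9278 / 10000 * d" "d' \<le> 1 / 4" "0 \<le> d'"
      using \<beta> e d \<epsilon> True by (auto simp: d'_def)
    have "d'\<^sup>2 \<le> (1 / 4)\<^sup>2" using d' by (intro power_mono) auto
    then have "d' * (11 / 8) \<le> d' * (3 / 2 - 2 * d'\<^sup>2)"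
      using d' by (intro mult_left_mono) (auto simp: power2_eq_square)
    then have "1 / 2 - d' * (3 / 2 - 2 * d'\<^sup>2) + \<eta> \<le> 1 / 2 - 6 / 5 * d"
      using d' \<eta> e d by linarith
    moreover have "tournament \<beta> \<eta> p (Suc i) \<le> 3 * (1 / 2 - d')\<^sup>2 - 2 * (1 / 2 - d') ^ 3 + \<eta>"
      using d' by (intro step) (auto simp: d'_def)
    moreover have "3 * (1 / 2 - d')\<^sup>2 - 2 * (1 / 2 - d') ^ 3 = 1 / 2 - d' * (3 / 2 - 2 * d'\<^sup>2)"
      by (simp add: power2_eq_square power3_eq_cube algebra_simps)
    ultimately show ?thesis using d by auto
  qed
  moreover have "0 \<le> tournament \<beta> \<eta> p (Suc i)"
    unfolding tournament.simps using IH \<beta> \<eta> d0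
    by (intro tournament_step_nonneg) auto
  ultimately show ?case by (simp add: e_def algebra_simps)
qed

text \<open>Bridges the gap from \<open>1 / 4\<close> to \<open>1 / 24\<close>, where squaring takes
  over, by a numerical table for the worst case \<open>\<beta> = 1 / 28\<close>,
  \<open>\<eta> = 1 / 784\<close>.\<close>

lemma tournament_descent:
  fixes \<beta> \<eta> p :: real
  assumes \<beta>: "0 \<le> \<beta>" "\<beta> \<le> 1 / 28" and \<eta>: "0 \<le> \<eta>" "\<eta> \<le> 1 / 784" and p: "0 \<le> p" "p \<le> 1 / 4"
    and i: "i \<le> 5"
  shows "0 \<le> tournament \<beta> \<eta> p i \<and> tournament \<beta> \<eta> p i \<le> [1/4, 1/5, 145/1000, 88/1000, 44/1000, 1/24] ! i"
proof -
  have step: "0 \<le> tournament \<beta> \<eta> p (Suc k) \<and> tournament \<beta> \<eta> p (Suc k) \<le> v"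
    if "0 \<le> tournament \<beta> \<eta> p k \<and> tournament \<beta> \<eta> p k \<le> u" "u \<le> 1 / 4"
      "3 * (u + 1 / 28)\<^sup>2 - 2 * (u + 1 / 28) ^ 3 + 1 / 784 \<le> v" for k u v
  proof -
    have "tournament \<beta> \<eta> p (Suc k) \<le> 3 * (u + 1 / 28)\<^sup>2 - 2 * (u + 1 / 28) ^ 3 + \<eta>"
      unfolding tournament.simps using that \<beta> by (intro tournament_step_mono) auto
    moreover have "0 \<le> tournament \<beta> \<eta> p (Suc k)"
      unfolding tournament.simps using that \<beta> \<eta> by (intro tournament_step_nonneg) auto
    ultimately show ?thesis using that \<eta> by linarith
  qed
  have 0: "0 \<le> tournament \<beta> \<eta> p 0 \<and> tournament \<beta> \<eta> p 0 \<le> 1 / 4" using p by simp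
  have 1: "0 \<le> tournament \<beta> \<eta> p 1 \<and> tournament \<beta> \<eta> p 1 \<le> 1 / 5"
    using step[OF 0, of "1/5"] by (simp add: power2_eq_square power3_eq_cube)
  have 2: "0 \<le> tournament \<beta> \<eta> p 2 \<and> tournament \<beta> \<eta> p 2 \<le> 145 / 1000"
    using step[OF 1, of "145/1000"]
    by (simp add: power2_eq_square power3_eq_cube numeral_2_eq_2 del: tournament.simps)
  have 3: "0 \<le> tournament \<beta> \<eta> p 3 \<and> tournament \<beta> \<eta> p 3 \<le> 88 / 1000"
    using step[OF 2, of "88/1000"]
    by (simp add: power2_eq_square power3_eq_cube del: tournament.simps)
  have 4: "0 \<le> tournament \<beta> \<eta> p 4 \<and> tournament \<beta> \<eta> p 4 \<le> 44 / 1000"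
    using step[OF 3, of "44/1000"]
    by (simp add: power2_eq_square power3_eq_cube del: tournament.simps)
  have 5: "0 \<le> tournament \<beta> \<eta> p 5 \<and> tournament \<beta> \<eta> p 5 \<le> 1 / 24"
    using step[OF 4, of "1/24"]
    by (simp add: power2_eq_square power3_eq_cube del: tournament.simps)
  from i consider "i = 0" | "i = 1" | "i = 2" | "i = 3" | "i = 4" | "i = 5" by linarith
  then show ?thesis using 0 1 2 3 4 5 by cases simp_all
qed

text \<open>If \<open>N \<ge> F\<close> bounds the fraction, the next one is at most
  \<open>3 * (2 * N)\<^sup>2 + N\<^sup>2 = 13 * N\<^sup>2\<close>. Hence \<open>13 * N\<close> is
  squared in every phase, starting from \<open>13 / 24 < 1\<close>, and the floor \<open>F\<close>
  is kept because \<open>13 * F \<le> 1\<close>.\<close>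

lemma tournament_squaring:
  fixes \<beta> \<eta> p F :: real
  assumes \<beta>: "0 \<le> \<beta>" "\<beta> \<le> F" and F: "F \<le> 1 / 28" and \<eta>: "0 \<le> \<eta>" "\<eta> \<le> F\<^sup>2"
    and p: "0 \<le> p" "p \<le> 1 / 24"
  shows "0 \<le> tournament \<beta> \<eta> p i \<and>
    tournament \<beta> \<eta> p i \<le> max F ((13 / 24) ^ (2 ^ i) / 13)"
proof (induction i)
  case 0
  then show ?case using p by auto
next
  case (Suc i)
  define u where "u = (13 / 24 :: real) ^ (2 ^ i)"
  have u: "0 \<le> u" "u \<le> 13 / 24"
    using power_decreasing[of 1 "2 ^ i" "13 / 24 :: real"] by (auto simp: u_def)
  define N where "N = max F (u / 13)"
  have N: "0 \<le> N" "N \<le> 1 / 24" "F \<le> N" using u \<beta> F by (auto simp: N_def)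
  define t where "t = tournament \<beta> \<eta> p i"
  have t: "0 \<le> t" "t \<le> N" using Suc by (auto simp: t_def N_def u_def)
  have "3 * (t + \<beta>)\<^sup>2 - 2 * (t + \<beta>) ^ 3 + \<eta> \<le> 3 * (t + \<beta>)\<^sup>2 + \<eta>" using t \<beta> by simp
  also have "\<dots> \<le> 3 * (2 * N)\<^sup>2 + N\<^sup>2"
  proof -
    have "(t + \<beta>)\<^sup>2 \<le> (2 * N)\<^sup>2" using t \<beta> N by (intro power_mono) linarith+
    moreover have "F\<^sup>2 \<le> N\<^sup>2" using \<beta> N by (intro power_mono) linarith+
    ultimately show ?thesis using \<eta> by linarith
  qed
  also have "\<dots> = 13 * N\<^sup>2" by (simp add: power2_eq_square)
  also have "\<dots> \<le> max F (u\<^sup>2 / 13)"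
  proof (cases "u / 13 \<le> F")
    case True
    then have "13 * N\<^sup>2 = (13 * F) * F" by (simp add: N_def power2_eq_square)
    also have "\<dots> \<le> 1 * F" using F \<beta> by (intro mult_right_mono) auto
    finally show ?thesis by simp
  next
    case False
    then show ?thesis by (simp add: N_def power2_eq_square)
  qed
  also have "u\<^sup>2 = (13 / 24) ^ (2 ^ Suc i)" by (simp add: u_def power_mult[symmetric] mult.commute)
  finally have "tournament \<beta> \<eta> p (Suc i) \<le> max F ((13 / 24) ^ (2 ^ Suc i) / 13)"
    by (simp add: t_def)
  moreover have "0 \<le> tournament \<beta> \<eta> p (Suc i)"
    unfolding tournament.simps using t \<beta> \<eta> N F
    by (intro tournament_step_nonneg) (auto simp: t_def)
  ultimately show ?case by blast
qed

text \<open>Chains \<open>k\<close> phases of growth, five of descent and \<open>j\<close> of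
  squaring. The bound at all intermediate times ensures that adding \<open>\<beta>\<close> still
  gives a probability.\<close>

lemma tournament_converges:
  fixes \<epsilon> \<beta> \<eta> p F :: real
  assumes \<epsilon>: "0 < \<epsilon>" and \<beta>: "0 \<le> \<beta>" "\<beta> \<le> \<epsilon> / 14" "\<beta> \<le> F"
    and F: "F \<le> 1 / 28" and \<eta>: "0 \<le> \<eta>" "\<eta> \<le> \<epsilon> / 20" "\<eta> \<le> F\<^sup>2"
    and p: "0 \<le> p" "p \<le> 1 / 2 - 99 / 100 * \<epsilon>"
    and k: "1 \<le> \<epsilon> * (6 / 5) ^ k" and j: "(13 / 24) ^ (2 ^ j) \<le> 13 * F"
  shows "\<And>i. i \<le> k + 5 + j \<Longrightarrow> 0 \<le> tournament \<beta> \<eta> p i \<and> tournament \<beta> \<eta> p i \<le> 1 / 2"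
    and "tournament \<beta> \<eta> p (k + 5 + j) \<le> F"
proof -
  have \<beta>28: "\<beta> \<le> 1 / 28" using \<beta> F by linarith
  have "F\<^sup>2 \<le> (1 / 28)\<^sup>2" using F \<beta> by (intro power_mono) auto
  then have \<eta>': "\<eta> \<le> 1 / 784" using \<eta> by (simp add: power2_eq_square)
  note G = tournament_growth[OF \<epsilon> \<beta>(1,2) \<beta>28 \<eta>(1,2) p]
  have k4: "0 \<le> tournament \<beta> \<eta> p k" "tournament \<beta> \<eta> p k \<le> 1 / 4" using G[of k] k by auto
  note D = tournament_descent[OF \<beta>(1) \<beta>28 \<eta>(1) \<eta>' k4]
  define r where "r = tournament \<beta> \<eta> p (k + 5)"
  have r: "0 \<le> r" "r \<le> 1 / 24" using D[of 5] by (auto simp: r_def tournament_add)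
  note S = tournament_squaring[OF \<beta>(1,3) F \<eta>(1,3) r]
  show "tournament \<beta> \<eta> p (k + 5 + j) \<le> F"
    using S[of j] j by (simp add: r_def tournament_add)
  fix i assume i: "i \<le> k + 5 + j"
  consider "i \<le> k" | i' where "i = k + i'" "i' \<le> 5" | i' where "i = k + 5 + i'"
  proof -
    have "i \<le> k \<or> (i = k + (i - k) \<and> i - k \<le> 5) \<or> i = k + 5 + (i - (k + 5))" by linarith
    then show thesis using that by blast
  qed
  then show "0 \<le> tournament \<beta> \<eta> p i \<and> tournament \<beta> \<eta> p i \<le> 1 / 2"
  proof cases
    case 1
    have "0 \<le> 99 / 100 * \<epsilon> * (6 / 5) ^ i" using \<epsilon> by simp
    then show ?thesis using G[of i] by linarith
  next
    case 2
    have "[1/4, 1/5, 145/1000, 88/1000, 44/1000, 1/24 :: real] ! i' \<le> 1 / 2"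
      using 2(2) by (auto simp: le_Suc_eq numeral_eq_Suc)
    then show ?thesis using D[OF 2(2)] 2(1) by (auto simp: tournament_add)
  next
    case 3
    have "(13 / 24 :: real) ^ (2 ^ i') \<le> 1" by (simp add: power_le_one)
    then have "max F ((13 / 24) ^ (2 ^ i') / 13) \<le> 1 / 2" using F by simp
    then show ?thesis using S[of i'] 3 by (auto simp: r_def tournament_add)
  qed
qed

text \<open>The union bound yields \<open>(8 * F) ^ k\<close>, and
  \<open>(8 * F) ^ 3 \<le> F\<close>, whence the factor 3 in the bound on \<open>k\<close>. A target
  quadratic in \<open>g\<close> leaves a margin below \<open>g / 2\<close> for either tail bound of
  the final phase.\<close>

lemma final_majority_prob:
  fixes F g q :: real
  assumes F: "0 < F" "F \<le> 1 / 28" and q: "0 \<le> q" "q \<le> 2 * F" and g: "0 < g"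
    and k: "3 * (2 * ln (1 / g) + ln 4) / ln (1 / F) \<le> real k"
  shows "majority_prob q (2 * k + 1) (2 * k + 1) 0 \<le> g\<^sup>2 / 4"
proof -
  have "majority_prob q (2 * k + 1) (2 * k + 1) 0 \<le> 2 ^ (2 * k + 1) * q ^ (k + 1)"
    using majority_prob_le[of q k "2 * k + 1" 0] q F by simp
  also have "\<dots> = (4 * q) ^ k * (2 * q)" by (simp add: power_mult power_mult_distrib)
  also have "\<dots> \<le> (8 * F) ^ k * 1"
  proof (rule mult_mono)
    show "(4 * q) ^ k \<le> (8 * F) ^ k" using q F by (intro power_mono) linarith+
  qed (use q F in auto)
  also have "\<dots> \<le> g\<^sup>2 / 4"
  proof -
    have "F\<^sup>2 \<le> (1 / 28)\<^sup>2" using F by (intro power_mono) auto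
    then have "512 * F\<^sup>2 \<le> 1" by (simp add: power2_eq_square)
    then have "F * (512 * F\<^sup>2) \<le> F * 1" using F by (intro mult_left_mono) auto
    then have F3: "(8 * F) ^ 3 \<le> F" by (simp add: power3_eq_cube power2_eq_square algebra_simps)
    have "((8 * F) ^ k) ^ 3 = ((8 * F) ^ 3) ^ k" by (simp only: power_mult[symmetric] mult.commute)
    also have "\<dots> \<le> F ^ k" using F F3 by (intro power_mono) auto
    also have "\<dots> = exp (- (ln (1 / F) * real k))"
      using F by (simp add: ln_div exp_of_nat2_mult)
    also have "\<dots> \<le> exp (- (3 * (2 * ln (1 / g) + ln 4)))"
      using k F by (simp add: divide_le_eq mult.commute)
    also have "\<dots> = (g\<^sup>2 / 4) ^ 3"
    proof -
      have "- (3 * (2 * ln (1 / g) + ln 4)) = real 3 * ln (g\<^sup>2 / 4)"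
        using g by (simp add: ln_div ln_realpow)
      then show ?thesis using g by (simp only: exp_of_nat_mult) simp
    qed
    finally have c: "((8 * F) ^ k) ^ 3 \<le> (g\<^sup>2 / 4) ^ 3" .
    have "(8 * F) ^ k \<le> g\<^sup>2 / 4"
      by (rule iffD1[OF power_mono_iff c]) (use F in auto)
    then show ?thesis by simp
  qed
  finally show ?thesis .
qed

subsection \<open>The tournament\<close>

text \<open>The entry at time 0 is never consulted, since \<open>current\<close> looks up the
  schedule only at positive times.\<close>

definition schedule :: "nat \<Rightarrow> nat \<Rightarrow> nat \<Rightarrow> nat" where
  "schedule m K t = (if t = 3 * m + K then K else if 3 dvd t \<and> t \<le> 3 * m then 3 else 0)"

lemma schedule_tournament:
  assumes "i < m" "0 < K"
  shows "0 < l \<Longrightarrow> l < 3 \<Longrightarrow> schedule m K (3 * i + l) = 0"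
    and "schedule m K (3 * i + 3) = 3"
proof -
  show "schedule m K (3 * i + l) = 0" if "0 < l" "l < 3"
  proof -
    have "\<not> 3 dvd 3 * i + l" using that by presburger
    moreover have "3 * i + l \<noteq> 3 * m + K" using assms that by linarith
    ultimately show ?thesis by (simp add: schedule_def)
  qed
  have "3 dvd 3 * i + 3" by presburger
  moreover have "3 * i + 3 \<noteq> 3 * m + K" "3 * i + 3 \<le> 3 * m" using assms by linarith+
  ultimately show "schedule m K (3 * i + 3) = 3" by (simp add: schedule_def)
qed

lemma schedule_final:
  shows "0 < l \<Longrightarrow> l < K \<Longrightarrow> schedule m K (3 * m + l) = 0"
    and "schedule m K (3 * m + K) = K"
  by (auto simp: schedule_def)

context median_gossip
begin

text \<open>A union bound over the phases, each adding the error of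
  \<open>phase_concentration\<close>.\<close>

lemma tournament_phases:
  assumes P: "majority_closed P" and \<beta>: "0 \<le> \<beta>" and \<eta>: "0 \<le> \<eta>"
    and ph: "\<And>i l. i < m \<Longrightarrow> 0 < l \<Longrightarrow> l < 3 \<Longrightarrow> ph (3 * i + l) = 0"
      "\<And>i. i < m \<Longrightarrow> ph (3 * i + 3) = 3"
    and init: "real (card {v. v < n \<and> P (x v)}) \<le> p * real n"
    and bounds: "\<And>i. i \<le> m \<Longrightarrow> 0 \<le> tournament \<beta> \<eta> p i \<and> tournament \<beta> \<eta> p i + \<beta> \<le> 1"
    and i: "i \<le> m"
  shows "measure_pmf.prob (execution n A adv x (3 * i))
      {st. tournament \<beta> \<eta> p i * real n < card (bad P (fst st))}
    \<le> real i * exp (- real n * \<eta>\<^sup>2 / 4)"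
  using i
proof (induction i)
  case 0
  have "bad P (\<lambda>v. init A (x v)) = {v. v < n \<and> P (x v)}"
    by (simp add: bad_def median_algorithm_def estimate_def)
  then show ?case using init by (simp add: measure_return_pmf indicator_def)
next
  case (Suc i)
  let ?q = "tournament \<beta> \<eta> p i + \<beta>"
  have "measure_pmf.prob (execution n A adv x (3 * i + 3))
      {st. tournament \<beta> \<eta> p (Suc i) * real n < card (bad P (fst st))}
    \<le> measure_pmf.prob (execution n A adv x (3 * i))
        {st. tournament \<beta> \<eta> p i * real n < card (bad P (fst st))} + exp (- real n * \<eta>\<^sup>2 / 4)"
  proof (rule phase_concentration[where q = ?q])
    show "majority_prob ?q 3 3 0 + \<eta> \<le> tournament \<beta> \<eta> p (Suc i)"
      by (simp add: majority_prob_3)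
    show "tournament \<beta> \<eta> p (Suc i) \<le> 1" using bounds[of "Suc i"] Suc.prems \<beta> by linarith
    show "0 \<le> ?q" "?q \<le> 1" using bounds[of i] Suc.prems \<beta> by auto
  qed (use P \<eta> ph Suc.prems in auto)
  then show ?case using Suc by (simp add: algebra_simps del: tournament.simps)
qed

text \<open>The level is \<open>g / 2\<close> because too high and too low values share the
  tolerance \<open>g\<close>. The two alternatives for \<open>d\<close> are the Chernoff bound, good
  unless \<open>g\<close> is tiny, and Markov's inequality, good if \<open>g\<close> is small, as
  the bound on the mean is quadratic in \<open>g\<close>.\<close>

lemma bad_nodes_after_final_phase:
  fixes \<epsilon> \<eta> F g :: real and k j \<kappa> :: nat
  defines "m \<equiv> k + 5 + j" and "K \<equiv> 2 * \<kappa> + 1"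
  assumes ph: "ph = schedule m K" and P: "majority_closed P"
    and \<epsilon>: "0 < \<epsilon>" and \<beta>: "0 \<le> \<beta>" "\<beta> \<le> \<epsilon> / 14" "\<beta> \<le> F"
    and F: "0 < F" "F \<le> 1 / 28" and \<eta>: "0 \<le> \<eta>" "\<eta> \<le> \<epsilon> / 20" "\<eta> \<le> F\<^sup>2"
    and p: "0 \<le> p" "p \<le> 1 / 2 - 99 / 100 * \<epsilon>"
    and init: "real (card {v. v < n \<and> P (x v)}) \<le> p * real n"
    and k: "1 \<le> \<epsilon> * (6 / 5) ^ k" and j: "(13 / 24) ^ (2 ^ j) \<le> 13 * F"
    and g: "0 < g" "g \<le> 1" and \<kappa>: "3 * (2 * ln (1 / g) + ln 4) / ln (1 / F) \<le> real \<kappa>"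
    and d: "exp (- real n * g\<^sup>2 / 64) \<le> d \<or> exp 1 * g / 2 \<le> d"
  shows "measure_pmf.prob (execution n A adv x (3 * m + K))
      {st. g / 2 * real n < card (bad P (fst st))}
    \<le> real m * exp (- real n * \<eta>\<^sup>2 / 4) + d"
proof -
  note T = tournament_converges[OF \<epsilon> \<beta> F(2) \<eta> p k j, folded m_def]
  define t where "t = tournament \<beta> \<eta> p m"
  have t: "0 \<le> t" "t \<le> F" using T(1)[of m] T(2) by (auto simp: t_def)
  have q: "0 \<le> t + \<beta>" "t + \<beta> \<le> 1" "t + \<beta> \<le> 2 * F" using t \<beta> F by auto
  have tour: "measure_pmf.prob (execution n A adv x (3 * m))
      {st. t * real n < card (bad P (fst st))} \<le> real m * exp (- real n * \<eta>\<^sup>2 / 4)"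
    unfolding t_def
  proof (rule tournament_phases[OF P \<beta>(1) \<eta>(1) _ _ init])
    show "ph (3 * i + l) = 0" if "i < m" "0 < l" "l < 3" for i l
      unfolding ph using that by (intro schedule_tournament) (auto simp: K_def)
    show "ph (3 * i + 3) = 3" if "i < m" for i
      unfolding ph using that by (intro schedule_tournament) (auto simp: K_def)
    show "0 \<le> tournament \<beta> \<eta> p i \<and> tournament \<beta> \<eta> p i + \<beta> \<le> 1" if "i \<le> m" for i
      using T(1)[OF that] \<beta> F by linarith
  qed simp
  have maj: "majority_prob (t + \<beta>) K K 0 \<le> g\<^sup>2 / 4"
    unfolding K_def by (rule final_majority_prob[OF F q(1,3) g(1) \<kappa>])
  have phK: "0 < l \<Longrightarrow> l < K \<Longrightarrow> ph (3 * m + l) = 0" for l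
    unfolding ph by (rule schedule_final(1))
  have phKK: "ph (3 * m + K) = K" unfolding ph by (rule schedule_final(2))
  have oddK: "odd K" by (simp add: K_def)
  have "measure_pmf.prob (execution n A adv x (3 * m + K))
      {st. g / 2 * real n < card (bad P (fst st))}
    \<le> measure_pmf.prob (execution n A adv x (3 * m)) {st. t * real n < card (bad P (fst st))} + d"
    using d
  proof
    assume d: "exp (- real n * g\<^sup>2 / 64) \<le> d"
    \<comment> \<open>The admissible fluctuation is \<open>g / 4\<close>, because
      \<open>g\<^sup>2 / 4 + g / 4 \<le> g / 2\<close>.\<close>
    have "g\<^sup>2 \<le> g * 1" unfolding power2_eq_square using g by (intro mult_left_mono) auto
    then have "measure_pmf.prob (execution n A adv x (3 * m + K))
        {st. g / 2 * real n < card (bad P (fst st))}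
      \<le> measure_pmf.prob (execution n A adv x (3 * m)) {st. t * real n < card (bad P (fst st))}
        + exp (- real n * (g / 4)\<^sup>2 / 4)"
      using maj g by (intro phase_concentration[OF q(1,2) oddK P phK phKK]) auto
    then show ?thesis using d by (simp add: power_divide)
  next
    assume d: "exp 1 * g / 2 \<le> d"
    have "measure_pmf.prob (execution n A adv x (3 * m + K))
        {st. g / 2 * real n < card (bad P (fst st))}
      \<le> measure_pmf.prob (execution n A adv x (3 * m)) {st. t * real n < card (bad P (fst st))}
        + exp 1 * (g\<^sup>2 / 4) / (g / 2)"
      using maj g by (intro phase_markov[OF q(1,2) oddK P phK phKK]) auto
    also have "exp 1 * (g\<^sup>2 / 4) / (g / 2) = exp 1 * g / 2"
      using g by (simp add: power2_eq_square)
    finally show ?thesis using d by linarith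
  qed
  then show ?thesis using tour by linarith
qed

end

section \<open>Values of unacceptable rank\<close>

definition too_high :: "nat \<Rightarrow> (nat \<Rightarrow> int) \<Rightarrow> real \<Rightarrow> int \<Rightarrow> bool" where
  "too_high n x \<epsilon> y \<longleftrightarrow> (1/2 + \<epsilon>) * real n < real (min_rank n x y)"

definition too_low :: "nat \<Rightarrow> (nat \<Rightarrow> int) \<Rightarrow> real \<Rightarrow> int \<Rightarrow> bool" where
  "too_low n x \<epsilon> y \<longleftrightarrow> real (max_rank n x y) < (1/2 - \<epsilon>) * real n"

lemma not_approx_median: "\<not> approx_median n x \<epsilon> y \<longleftrightarrow> too_high n x \<epsilon> y \<or> too_low n x \<epsilon> y"
  by (auto simp: approx_median_def too_high_def too_low_def)

lemma min_rank_mono: "y \<le> z \<Longrightarrow> min_rank n x y \<le> min_rank n x z"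
  unfolding min_rank_def by (auto intro!: card_mono)

lemma max_rank_mono: "y \<le> z \<Longrightarrow> max_rank n x y \<le> max_rank n x z"
  unfolding max_rank_def by (auto intro!: card_mono)

lemma majority_closed_too_high: "majority_closed (too_high n x \<epsilon>)"
  using min_rank_mono[of _ _ n x]
  by (intro majority_closed_up) (fastforce simp: too_high_def)

lemma majority_closed_too_low: "majority_closed (too_low n x \<epsilon>)"
  using max_rank_mono[of _ _ n x]
  by (intro majority_closed_down) (fastforce simp: too_low_def)

text \<open>More than \<open>(1/2 + \<epsilon>) * n - 1\<close> nodes lie strictly below the least
  initial value that is too high, and none of them is too high itself. The 1 comes from
  \<open>min_rank\<close> and turns into the term \<open>1 / real n\<close>.\<close>

lemma card_too_high:
  assumes "n > 0" "\<epsilon> < 1 / 2"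
  shows "real (card {v. v < n \<and> too_high n x \<epsilon> (x v)}) \<le> (1/2 - \<epsilon> + 1 / real n) * real n"
proof (cases "{v. v < n \<and> too_high n x \<epsilon> (x v)} = {}")
  case True
  then show ?thesis using assms by (simp only: True) (auto intro!: mult_nonneg_nonneg)
next
  case False
  let ?S = "{v. v < n \<and> too_high n x \<epsilon> (x v)}"
  have "finite (x ` ?S)" "x ` ?S \<noteq> {}" using False by auto
  then have "Min (x ` ?S) \<in> x ` ?S" by (rule Min_in)
  then obtain w where w: "w \<in> ?S" "x w = Min (x ` ?S)" by auto
  have le: "x w \<le> x v" if "v \<in> ?S" for v unfolding w(2) using that by (intro Min_le) auto
  let ?L = "{v. v < n \<and> x v < x w}"
  have "?S \<inter> ?L = {}" using le by force
  then have "card ?S + card ?L = card (?S \<union> ?L)" by (subst card_Un_disjoint) auto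
  also have "\<dots> \<le> card {..<n}" by (intro card_mono) auto
  finally have "real (card ?S) + real (card ?L) \<le> real n" by simp
  moreover have "(1/2 + \<epsilon>) * real n < real (card ?L) + 1"
    using w(1) by (simp add: too_high_def min_rank_def add.commute)
  ultimately show ?thesis using assms(1) by (simp add: algebra_simps)
qed

text \<open>All these nodes are counted by \<open>max_rank\<close> of the greatest initial value
  that is too low. The bound has the form of \<open>card_too_high\<close>, so that both kinds start
  with the same \<open>p\<close>.\<close>

lemma card_too_low:
  assumes "n > 0" "\<epsilon> < 1 / 2"
  shows "real (card {v. v < n \<and> too_low n x \<epsilon> (x v)}) \<le> (1/2 - \<epsilon> + 1 / real n) * real n"
proof (cases "{v. v < n \<and> too_low n x \<epsilon> (x v)} = {}")
  case True
  then show ?thesis using assms by (simp only: True) (auto intro!: mult_nonneg_nonneg)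
next
  case False
  let ?S = "{v. v < n \<and> too_low n x \<epsilon> (x v)}"
  have "finite (x ` ?S)" "x ` ?S \<noteq> {}" using False by auto
  then have "Max (x ` ?S) \<in> x ` ?S" by (rule Max_in)
  then obtain w where w: "w \<in> ?S" "x w = Max (x ` ?S)" by auto
  have le: "x v \<le> x w" if "v \<in> ?S" for v unfolding w(2) using that by (intro Max_ge) auto
  have "card ?S \<le> card {v. v < n \<and> x v \<le> x w}" using le by (intro card_mono) auto
  then have "real (card ?S) \<le> (1/2 - \<epsilon>) * real n"
    using w(1) by (simp add: too_low_def max_rank_def)
  then show ?thesis using assms(1) by (simp add: algebra_simps)
qed

text \<open>Allows stopping after zero rounds for \<open>\<epsilon> \<ge> 1 / 2\<close>. This
  matters because \<open>round_bound\<close> comes arbitrarily close to 0 when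
  \<open>\<epsilon>\<close> and \<open>\<gamma>\<close> approach 1, so not even one round could be
  afforded.\<close>

lemma approx_median_initial_value:
  assumes "1 / 2 \<le> \<epsilon>" "v < n"
  shows "approx_median n x \<epsilon> (x v)"
proof -
  have "(1/2 - \<epsilon>) * real n \<le> 0" using assms by (intro mult_nonpos_nonneg) auto
  moreover have "card {u. u < n \<and> x u < x v} < card {..<n}"
    using assms(2) by (intro psubset_card_mono) auto
  then have "real (min_rank n x (x v)) \<le> 1 * real n" by (simp add: min_rank_def)
  moreover have "1 * real n \<le> (1/2 + \<epsilon>) * real n" using assms by (intro mult_right_mono) auto
  ultimately show ?thesis unfolding approx_median_def by linarith
qed

subsection \<open>Parameters and running time\<close>

text \<open>Correctness level below \<open>1 / n\<close> means that no node errs, so smaller \<open>\<gamma>\<close> can be replaced by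
  \<open>1 / (2 n)\<close>; this keeps all phase lengths logarithmic in \<open>n\<close>.\<close>

definition target_level :: "nat \<Rightarrow> real \<Rightarrow> real" where
  "target_level n \<gamma> = max \<gamma> (1 / (2 * real n))"

text \<open>The level to be reached by the tournament. The power of \<open>n\<close> keeps its
  square above the fluctuation \<open>n powr (- 1/3)\<close> for large \<open>n\<close>, the target
  level limits the number of squaring phases, and the 28 matches the bound
  \<open>F \<le> 1 / 28\<close> of the recursion.\<close>

definition bad_floor :: "nat \<Rightarrow> real \<Rightarrow> real \<Rightarrow> real" where
  "bad_floor n \<beta> \<gamma> = max \<beta> (max (target_level n \<gamma>) (real n powr (- 1/8)) / 28)"

definition growth_phases :: "real \<Rightarrow> nat" where
  "growth_phases \<epsilon> = nat \<lceil>ln (1 / \<epsilon>) / ln (6 / 5)\<rceil>"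

definition squaring_phases :: "real \<Rightarrow> nat" where
  "squaring_phases g = nat \<lceil>log 2 (4 * max 1 (ln (1 / g)))\<rceil>"

definition final_length :: "real \<Rightarrow> real \<Rightarrow> nat" where
  "final_length F g = nat \<lceil>3 * (2 * ln (1 / g) + ln 4) / ln (1 / F)\<rceil>"

definition tournament_phases :: "nat \<Rightarrow> real \<Rightarrow> real \<Rightarrow> nat" where
  "tournament_phases n \<epsilon> \<gamma> = growth_phases \<epsilon> + 5 + squaring_phases (target_level n \<gamma>)"

definition final_samples :: "nat \<Rightarrow> real \<Rightarrow> real \<Rightarrow> nat" where
  "final_samples n \<beta> \<gamma> = 2 * final_length (bad_floor n \<beta> \<gamma>) (target_level n \<gamma>) + 1"

definition running_time :: "nat \<Rightarrow> real \<Rightarrow> real \<Rightarrow> real \<Rightarrow> nat" where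
  "running_time n \<epsilon> \<beta> \<gamma> =
     (if 1 / 2 \<le> \<epsilon> then 0 else 3 * tournament_phases n \<epsilon> \<gamma> + final_samples n \<beta> \<gamma>)"

lemma target_level:
  assumes "n \<ge> 1" "0 < \<gamma>" "\<gamma> < 1"
  shows "0 < target_level n \<gamma>" "target_level n \<gamma> < 1" "\<gamma> \<le> target_level n \<gamma>"
    "ln (1 / target_level n \<gamma>) \<le> ln (1 / \<gamma>)" "ln (1 / target_level n \<gamma>) \<le> ln (2 * real n)"
    "0 \<le> ln (1 / target_level n \<gamma>)"
proof -
  let ?g = "target_level n \<gamma>"
  show g: "0 < ?g" "?g < 1" "\<gamma> \<le> ?g" using assms by (auto simp: target_level_def field_simps)
  show "ln (1 / ?g) \<le> ln (1 / \<gamma>)" using g assms by (simp add: frac_le)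
  have "1 / (2 * real n) \<le> ?g" by (simp add: target_level_def)
  then have "1 / ?g \<le> 2 * real n" using g assms by (simp add: field_simps)
  then show "ln (1 / ?g) \<le> ln (2 * real n)" using g by (intro ln_mono) auto
  show "0 \<le> ln (1 / ?g)" using g by simp
qed

lemma bad_floor:
  assumes "n \<ge> 1" "0 < \<gamma>" "\<gamma> < 1" "0 < \<beta>" "\<beta> \<le> 1 / 28"
  shows "0 < bad_floor n \<beta> \<gamma>" "bad_floor n \<beta> \<gamma> \<le> 1 / 28" "\<beta> \<le> bad_floor n \<beta> \<gamma>"
    "target_level n \<gamma> / 28 \<le> bad_floor n \<beta> \<gamma>" "real n powr (- 1/8) / 28 \<le> bad_floor n \<beta> \<gamma>"
proof -
  have "real n powr (- 1/8) \<le> real n powr 0" using assms(1) by (intro powr_mono) auto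
  then have "real n powr (- 1/8) \<le> 1" using assms(1) by simp
  then show "bad_floor n \<beta> \<gamma> \<le> 1 / 28"
    using target_level(2)[OF assms(1-3)] assms by (simp add: bad_floor_def)
  show "0 < bad_floor n \<beta> \<gamma>" "\<beta> \<le> bad_floor n \<beta> \<gamma>"
    "target_level n \<gamma> / 28 \<le> bad_floor n \<beta> \<gamma>" "real n powr (- 1/8) / 28 \<le> bad_floor n \<beta> \<gamma>"
    using assms by (auto simp: bad_floor_def)
qed

lemma nat_ceiling_le: "0 \<le> a \<Longrightarrow> real (nat \<lceil>a\<rceil>) \<le> a + 1"
  by linarith

lemma ln2_ge_half: "1 / 2 \<le> ln (2 :: real)"
  using ln_le_minus_one[of "1 / 2 :: real"] by (simp add: ln_div)

lemma growth_phases: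
  assumes "0 < \<epsilon>" "\<epsilon> < 1"
  shows "1 \<le> \<epsilon> * (6 / 5) ^ growth_phases \<epsilon>" "real (growth_phases \<epsilon>) \<le> 6 * ln (1 / \<epsilon>) + 1"
proof -
  have l: "1 / 6 \<le> ln (6 / 5 :: real)"
    using ln_le_minus_one[of "5 / 6 :: real"] by (simp add: ln_div)
  have e0: "0 \<le> ln (1 / \<epsilon>)" using assms by simp
  have "ln (1 / \<epsilon>) / ln (6 / 5) \<le> real (growth_phases \<epsilon>)"
    unfolding growth_phases_def by linarith
  then have "ln (1 / \<epsilon>) \<le> real (growth_phases \<epsilon>) * ln (6 / 5)"
    using l by (simp add: divide_le_eq)
  then have "exp (ln (1 / \<epsilon>)) \<le> exp (real (growth_phases \<epsilon>) * ln (6 / 5))" by simp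
  also have "\<dots> = (6 / 5) ^ growth_phases \<epsilon>" by (simp add: exp_of_nat_mult)
  finally show "1 \<le> \<epsilon> * (6 / 5) ^ growth_phases \<epsilon>" using assms by (simp add: field_simps)
  have "real (growth_phases \<epsilon>) \<le> ln (1 / \<epsilon>) / ln (6 / 5) + 1"
    unfolding growth_phases_def using e0 l by (intro nat_ceiling_le) auto
  also have "ln (1 / \<epsilon>) / ln (6 / 5) \<le> ln (1 / \<epsilon>) / (1 / 6)"
    using e0 l by (intro divide_left_mono) auto
  finally show "real (growth_phases \<epsilon>) \<le> 6 * ln (1 / \<epsilon>) + 1" by simp
qed

lemma squaring_phases:
  assumes "0 < g" "g \<le> 1"
  shows "(13 / 24) ^ (2 ^ squaring_phases g) \<le> 13 * (g / 28)"
    and "real (squaring_phases g) \<le> 3 + 2 * ln (max 1 (ln (1 / g)))"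
proof -
  define L where "L = max 1 (ln (1 / g))"
  define j where "j = squaring_phases g"
  have L: "1 \<le> L" "ln (1 / g) \<le> L" by (auto simp: L_def)
  have lg: "log 2 (4 * L) = 2 + log 2 L"
    using log_mult[of 2 4 L] log_nat_power[of 2 2 2] L by simp
  have "log 2 (4 * L) \<le> real j" unfolding j_def squaring_phases_def L_def by linarith
  then have "4 * L \<le> 2 powr real j" using L by (subst (asm) log_le_iff) auto
  then have j: "4 * L \<le> 2 ^ j" by (simp add: powr_realpow)
  have l: "11 / 24 \<le> ln (24 / 13 :: real)"
    using ln_le_minus_one[of "13 / 24 :: real"] by (simp add: ln_div)
  have l2: "ln (28 / 13 :: real) \<le> 5 / 6"
  proof -
    have "ln (28 / 13 :: real) = ln 2 + ln (14 / 13)" using ln_mult[of 2 "14 / 13 :: real"] by simp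
    then show ?thesis
      using ln2_le_25_over_36 ln_le_minus_one[of "14 / 13 :: real"] by simp
  qed
  have "ln (28 / (13 * g)) = ln (28 / 13) + ln (1 / g)"
    using assms by (simp add: ln_div ln_mult)
  \<comment> \<open>\<open>5 / 6 + L \<le> 11 / 6 * L\<close> since \<open>L \<ge> 1\<close>; this
    explains the 4 in \<open>squaring_phases\<close>.\<close>
  also have "\<dots> \<le> 11 / 24 * (4 * L)" using l2 L by linarith
  also have "\<dots> \<le> ln (24 / 13) * 2 ^ j" using l j L by (intro mult_mono) auto
  finally have "exp (ln (28 / (13 * g))) \<le> exp (real (2 ^ j) * ln (24 / 13))"
    by (simp add: mult.commute)
  also have "\<dots> = (24 / 13) ^ (2 ^ j)" by (subst exp_of_nat_mult) simp
  finally have "28 / (13 * g) \<le> (24 / 13) ^ (2 ^ j)" using assms by simp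
  then have "inverse ((24 / 13) ^ (2 ^ j)) \<le> inverse (28 / (13 * g))"
    using assms by (intro le_imp_inverse_le) auto
  then show "(13 / 24) ^ (2 ^ squaring_phases g) \<le> 13 * (g / 28)"
    by (simp add: j_def power_inverse[symmetric])
  have "real (squaring_phases g) \<le> log 2 (4 * L) + 1"
    unfolding squaring_phases_def L_def[symmetric] using L by (intro nat_ceiling_le) auto
  also have "\<dots> = 3 + ln L / ln 2" unfolding lg by (simp add: log_def)
  also have "ln L / ln 2 \<le> ln L / (1 / 2)"
    using ln2_ge_half L by (intro divide_left_mono) auto
  finally show "real (squaring_phases g) \<le> 3 + 2 * ln (max 1 (ln (1 / g)))" by (simp add: L_def)
qed

text \<open>If \<open>\<beta>\<close> is the floor, the quotient is the one in
  \<open>round_bound\<close> up to constants. Otherwise the floor is at least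
  \<open>n powr (- 1/8) / 28\<close> and tied to \<open>g\<close> or to this power; as
  \<open>g \<ge> 1 / (2 * n)\<close>, numerator and denominator are then comparable and the final
  phase has bounded length.\<close>

lemma final_length:
  assumes n: "n \<ge> 1" and \<gamma>: "0 < \<gamma>" "\<gamma> < 1" and \<beta>: "0 < \<beta>" "\<beta> \<le> 1 / 28"
  defines "F \<equiv> bad_floor n \<beta> \<gamma>" and "g \<equiv> target_level n \<gamma>"
  shows "3 * (2 * ln (1 / g) + ln 4) / ln (1 / F) \<le> real (final_length F g)"
    and "real (final_length F g) \<le> 49 + 6 * (ln (1 / \<gamma>) / ln (1 / \<beta>))"
proof -
  let ?L = "2 * ln (1 / g) + ln 4"
  note G = target_level[OF n \<gamma>, folded g_def]
  note B = bad_floor[OF n \<gamma> \<beta>, folded g_def F_def]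
  show "3 * ?L / ln (1 / F) \<le> real (final_length F g)"
    unfolding final_length_def by linarith
  have ln4: "ln (4 :: real) \<le> ln 28" by simp
  have l28: "ln 28 \<le> ln (1 / F)" using B by (intro ln_mono) (auto simp: field_simps)
  have pos: "0 < ln (28 :: real)" by simp
  have L0: "0 \<le> ?L" using G by simp
  have R0: "0 \<le> ln (1 / \<gamma>) / ln (1 / \<beta>)" using \<gamma> \<beta> by simp
  have "?L / ln (1 / F) \<le> 16 + 2 * (ln (1 / \<gamma>) / ln (1 / \<beta>))"
  proof (cases "F = \<beta>")
    case True
    have "?L / ln (1 / F) = 2 * (ln (1 / g) / ln (1 / \<beta>)) + ln 4 / ln (1 / F)"
      by (simp add: True add_divide_distrib)
    also have "\<dots> \<le> 2 * (ln (1 / \<gamma>) / ln (1 / \<beta>)) + 1"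
    proof (intro add_mono mult_left_mono divide_right_mono)
      have "ln 4 \<le> ln (1 / F)" "0 < ln (1 / F)" using ln4 l28 pos by linarith+
      then show "ln 4 / ln (1 / F) \<le> 1" by (simp only: divide_le_eq_1_pos)
    qed (use G \<beta> in auto)
    finally show ?thesis by linarith
  next
    case False
    define g' where "g' = max g (real n powr (- 1/8))"
    have "F = max \<beta> (g' / 28)" by (simp add: F_def bad_floor_def g'_def g_def)
    then have F: "F = g' / 28" using False by (auto simp: max_def split: if_splits)
    have g': "0 < g'" using G by (simp add: g'_def)
    have lF: "ln (1 / F) = ln 28 + ln (1 / g')" using g' by (simp add: F ln_div)
    have "ln (1 / g) \<le> 8 * ln (1 / g') + ln 2"
    proof (cases "g' = g")
      case True
      then have "ln (1 / g') = ln (1 / g)" by simp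
      then show ?thesis using G ln2_ge_half by linarith
    next
      case False
      then have "g' = real n powr (- 1/8)" unfolding g'_def by (metis max_def)
      then have "8 * ln (1 / g') = ln (real n)" using n by (simp add: ln_div ln_powr)
      moreover have "ln (2 * real n) = ln 2 + ln (real n)" using n by (simp add: ln_mult)
      ultimately show ?thesis using G by linarith
    qed
    moreover have "ln (4 :: real) = 2 * ln 2" using ln_realpow[of 2 2] by simp
    moreover have "ln (2 :: real) \<le> ln 28" by simp
    ultimately have "?L \<le> 16 * ln (1 / F)" using lF pos by linarith
    moreover have "0 < ln (1 / F)" using l28 pos by linarith
    ultimately have "?L / ln (1 / F) \<le> 16" by (simp only: pos_divide_le_eq)
    then show ?thesis using R0 by linarith
  qed
  moreover have "3 * ?L / ln (1 / F) = 3 * (?L / ln (1 / F))"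
    by (simp only: times_divide_eq_right)
  ultimately have "3 * ?L / ln (1 / F) + 1 \<le> 49 + 6 * (ln (1 / \<gamma>) / ln (1 / \<beta>))"
    by linarith
  moreover have "real (final_length F g) \<le> 3 * ?L / ln (1 / F) + 1"
    unfolding final_length_def using L0 l28 pos
    by (intro nat_ceiling_le divide_nonneg_nonneg mult_nonneg_nonneg) linarith+
  ultimately show "real (final_length F g) \<le> 49 + 6 * (ln (1 / \<gamma>) / ln (1 / \<beta>))" by linarith
qed

text \<open>For \<open>\<epsilon> < 1 / 2\<close> the term
  \<open>ln (1 / \<epsilon>) \<ge> 1 / 2\<close> absorbs all additive constants; otherwise no round
  takes place.\<close>

lemma running_time_le:
  assumes n: "n \<ge> 1" and \<epsilon>: "0 < \<epsilon>" "\<epsilon> < 1" and \<gamma>: "0 < \<gamma>" "\<gamma> < 1"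
    and \<beta>: "0 < \<beta>" "\<beta> \<le> \<epsilon> / 14"
  shows "real (running_time n \<epsilon> \<beta> \<gamma>) \<le> 300 * round_bound \<epsilon> \<beta> \<gamma>"
proof -
  have R: "0 \<le> ln (1 / \<gamma>) / ln (1 / \<beta>)" "0 \<le> ln (1 / \<epsilon>)" using \<epsilon> \<gamma> \<beta> by auto
  show ?thesis
  proof (cases "1 / 2 \<le> \<epsilon>")
    case True
    then show ?thesis using R by (simp add: running_time_def round_bound_def)
  next
    case False
    let ?g = "target_level n \<gamma>"
    note G = target_level[OF n \<gamma>]
    have "ln 2 \<le> ln (1 / \<epsilon>)" using False \<epsilon> by (intro ln_mono) (auto simp: field_simps)
    then have e: "1 / 2 \<le> ln (1 / \<epsilon>)" using ln2_ge_half by linarith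
    have \<beta>28: "\<beta> \<le> 1 / 28" using \<beta> False by linarith
    have "ln (max 1 (ln (1 / ?g))) \<le> max 0 (ln (ln (1 / \<gamma>)))"
      using G by (cases "ln (1 / ?g) \<le> 1") (auto simp: max_def)
    then have "real (squaring_phases ?g) \<le> 3 + 2 * max 0 (ln (ln (1 / \<gamma>)))"
      using squaring_phases(2)[of ?g] G by linarith
    moreover have "real (running_time n \<epsilon> \<beta> \<gamma>) = 3 * (real (growth_phases \<epsilon>) + 5
        + real (squaring_phases ?g)) + 2 * real (final_length (bad_floor n \<beta> \<gamma>) ?g) + 1"
      using False by (simp add: running_time_def tournament_phases_def final_samples_def)
    ultimately show ?thesis
      using growth_phases(2)[OF \<epsilon>] final_length(2)[OF n \<gamma> \<beta>(1) \<beta>28] e R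
      unfolding round_bound_def by argo
  qed
qed

subsection \<open>Correctness\<close>

text \<open>The two extra bits cover the sign and the value 0: there are
  \<open>2 * n ^ k + 1\<close> values to encode.\<close>

definition message_bits :: "nat \<Rightarrow> nat \<Rightarrow> nat" where
  "message_bits k n = 2 + k * nat \<lceil>log 2 (max 1 (real n))\<rceil>"

lemma message_bits_sufficient: "2 * int n ^ k + 1 \<le> 2 ^ message_bits k n"
proof -
  define l where "l = nat \<lceil>log 2 (max 1 (real n))\<rceil>"
  have "log 2 (max 1 (real n)) \<le> real l" unfolding l_def by linarith
  then have "max 1 (real n) \<le> 2 powr real l" by (subst (asm) log_le_iff) auto
  then have "real n \<le> 2 ^ l" by (simp add: powr_realpow)
  then have "real n \<le> real (2 ^ l)" by simp
  then have "n \<le> 2 ^ l" by (simp only: of_nat_le_iff)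
  then have "n ^ k \<le> (2 ^ l) ^ k" by (rule power_mono) simp
  also have "(2 ^ l) ^ k = (2 :: nat) ^ (k * l)" by (simp add: power_mult[symmetric] mult.commute)
  finally have "n ^ k \<le> 2 ^ (k * l)" .
  moreover have "2 ^ message_bits k n = 4 * (2 :: nat) ^ (k * l)"
    by (simp add: message_bits_def l_def power_add)
  moreover have "1 \<le> (2 :: nat) ^ (k * l)" by simp
  ultimately have "2 * n ^ k + 1 \<le> 2 ^ message_bits k n" by linarith
  then have "int (2 * n ^ k + 1) \<le> int (2 ^ message_bits k n)" by (simp only: of_nat_le_iff)
  then show ?thesis by simp
qed

lemma message_bits_bigo: "(\<lambda>n. real (message_bits k n)) \<in> O(\<lambda>n. ln (real n))"
proof (rule bigoI)
  show "\<forall>\<^sub>F n in sequentially. norm (real (message_bits k n)) \<le> (2 + 3 * real k) * norm (ln (real n))"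
    using eventually_ge_at_top[of 3]
  proof eventually_elim
    case (elim n)
    have "exp 1 \<le> real n" using exp_le elim by linarith
    then have l: "1 \<le> ln (real n)" using elim by (simp add: ln_ge_iff)
    have "log 2 (real n) \<le> ln (real n) / (1 / 2)"
      unfolding log_def using ln2_ge_half l by (intro divide_left_mono) auto
    then have "log 2 (real n) \<le> 2 * ln (real n)" by simp
    moreover have mx: "max 1 (real n) = real n" using elim by simp
    moreover have "real (nat \<lceil>log 2 (real n)\<rceil>) \<le> log 2 (real n) + 1"
      using elim by (intro nat_ceiling_le) simp
    ultimately have "real (nat \<lceil>log 2 (max 1 (real n))\<rceil>) \<le> 3 * ln (real n)"
      unfolding mx using l by linarith
    then have "real k * real (nat \<lceil>log 2 (max 1 (real n))\<rceil>) \<le> real k * (3 * ln (real n))"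
      by (intro mult_left_mono) auto
    moreover have "real (message_bits k n) = 2 + real k * real (nat \<lceil>log 2 (max 1 (real n))\<rceil>)"
      by (simp add: message_bits_def)
    moreover have "(2 + 3 * real k) * ln (real n) = 2 * ln (real n) + real k * (3 * ln (real n))"
      by (simp add: distrib_right)
    ultimately have "real (message_bits k n) \<le> (2 + 3 * real k) * ln (real n)"
      using l by linarith
    then show ?case using l by simp
  qed
qed

text \<open>Raising \<open>\<gamma>\<close> to \<open>1 / (2 * n)\<close> loses nothing: a positive
  number of errors is at least 1, hence above \<open>1 / 2\<close>. One of the two kinds then
  exceeds half of the tolerance.\<close>

lemma correctness_failure:
  assumes "n \<ge> 1" "0 < \<gamma>" "\<gamma> < 1" "\<not> correctness_level n x \<epsilon> \<gamma> y"
  shows "target_level n \<gamma> / 2 * real n < real (card {v. v < n \<and> too_high n x \<epsilon> (y v)}) \<or>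
         target_level n \<gamma> / 2 * real n < real (card {v. v < n \<and> too_low n x \<epsilon> (y v)})"
proof -
  let ?N = "card {v. v < n \<and> \<not> approx_median n x \<epsilon> (y v)}"
  have N: "\<gamma> * real n < real ?N" using assms(4) by (simp add: correctness_level_def)
  have g: "target_level n \<gamma> * real n < real ?N"
  proof (cases "target_level n \<gamma> = \<gamma>")
    case False
    then have "target_level n \<gamma> * real n = 1 / 2"
      using assms(1) by (simp add: target_level_def max_def split: if_splits)
    moreover have "0 < \<gamma> * real n" using assms by simp
    then have "0 < real ?N" using N by linarith
    then have "1 \<le> real ?N" by simp
    ultimately show ?thesis by linarith
  qed (use N in simp)
  have "{v. v < n \<and> \<not> approx_median n x \<epsilon> (y v)}
      = {v. v < n \<and> too_high n x \<epsilon> (y v)} \<union> {v. v < n \<and> too_low n x \<epsilon> (y v)}"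
    by (auto simp: not_approx_median)
  then have "?N \<le> card {v. v < n \<and> too_high n x \<epsilon> (y v)} + card {v. v < n \<and> too_low n x \<epsilon> (y v)}"
    by (simp add: card_Un_le)
  then show ?thesis using g by linarith
qed

lemma median_algorithm_correct:
  fixes n :: nat and \<epsilon> \<beta> \<gamma> :: real
  defines "m \<equiv> tournament_phases n \<epsilon> \<gamma>" and "K \<equiv> final_samples n \<beta> \<gamma>"
  assumes G: "median_gossip n enc dec M x adv \<beta>"
    and n: "n \<ge> 1" and \<epsilon>: "0 < \<epsilon>" "\<epsilon> < 1 / 2" and \<gamma>: "0 < \<gamma>" "\<gamma> < 1"
    and \<beta>: "0 < \<beta>" "\<beta> \<le> \<epsilon> / 14"
    and large: "1 / real n \<le> \<epsilon> / 100" "real n powr (-1/3) \<le> \<epsilon> / 20"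
      "real n powr (-1/3) \<le> (real n powr (-1/8) / 28)\<^sup>2"
    and d: "exp (- (real n powr (1/2)) / 64) \<le> d" "2 * real n powr (-1/4) \<le> d"
  shows "1 - 2 * (real m * exp (- (real n powr (1/3)) / 4) + d) \<le>
    measure_pmf.prob (outputs n (median_algorithm enc dec (schedule m K)) adv x (running_time n \<epsilon> \<beta> \<gamma>))
      {y. correctness_level n x \<epsilon> \<gamma> y}"
proof -
  interpret median_gossip n enc dec M "schedule m K" x adv \<beta> by (rule G)
  define g where "g = target_level n \<gamma>"
  define F where "F = bad_floor n \<beta> \<gamma>"
  \<comment> \<open>Small enough for the bounds \<open>\<epsilon> / 20\<close> and
    \<open>F\<^sup>2\<close>, while \<open>n * \<eta>\<^sup>2\<close> is still a positive power of
    \<open>n\<close>.\<close>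
  define \<eta> where "\<eta> = real n powr (-1/3)"
  define T where "T = running_time n \<epsilon> \<beta> \<gamma>"
  have \<beta>28: "\<beta> \<le> 1 / 28" using \<beta> \<epsilon> by linarith
  note TL = target_level[OF n \<gamma>, folded g_def]
  note BF = bad_floor[OF n \<gamma> \<beta>(1) \<beta>28, folded g_def F_def]
  have m: "m = growth_phases \<epsilon> + 5 + squaring_phases g"
    by (simp add: m_def tournament_phases_def g_def)
  have K: "K = 2 * final_length F g + 1"
    by (simp add: K_def final_samples_def F_def g_def)
  have T: "T = 3 * m + K" using \<epsilon> by (simp add: T_def running_time_def m_def K_def)
  have \<eta>F: "\<eta> \<le> F\<^sup>2"
  proof -
    have "(real n powr (-1/8) / 28)\<^sup>2 \<le> F\<^sup>2" using BF by (intro power_mono) auto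
    then show ?thesis using large by (simp add: \<eta>_def)
  qed
  have n\<eta>: "real n * \<eta>\<^sup>2 = real n powr (1/3)"
  proof -
    have "real n * \<eta>\<^sup>2 = real n powr 1 * (real n powr (-1/3) * real n powr (-1/3))"
      using n by (simp add: \<eta>_def power2_eq_square)
    also have "\<dots> = real n powr (1/3)" by (simp only: powr_add[symmetric]) simp
    finally show ?thesis .
  qed
  \<comment> \<open>Up to \<open>n powr (-1/4)\<close> Markov's inequality applies; above it
    \<open>n * g\<^sup>2\<close> is at least \<open>n powr (1/2)\<close>, enough for the Chernoff
    bound.\<close>
  have dg: "exp (- real n * g\<^sup>2 / 64) \<le> d \<or> exp 1 * g / 2 \<le> d"
  proof (cases "g \<le> real n powr (-1/4)")
    case True
    have "exp 1 * g \<le> 3 * real n powr (-1/4)"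
      using True TL exp_le by (intro mult_mono) auto
    moreover have "0 \<le> real n powr (-1/4)" by simp
    ultimately show ?thesis using d(2) by linarith
  next
    case False
    have "real n powr (1/2) = real n powr 1 * (real n powr (-1/4) * real n powr (-1/4))"
      by (simp only: powr_add[symmetric]) simp
    also have "\<dots> = real n * (real n powr (-1/4))\<^sup>2"
      using n by (simp add: power2_eq_square)
    also have "\<dots> \<le> real n * g\<^sup>2"
      using False by (intro mult_left_mono power_mono) auto
    finally have "exp (- real n * g\<^sup>2 / 64) \<le> exp (- (real n powr (1/2)) / 64)" by simp
    then show ?thesis using d(1) by linarith
  qed
  have fail: "measure_pmf.prob (execution n A adv x T)
      {st. g / 2 * real n < card (bad P (fst st))}
    \<le> real m * exp (- (real n powr (1/3)) / 4) + d"
    if P: "majority_closed P"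
      and init: "real (card {v. v < n \<and> P (x v)}) \<le> (1/2 - \<epsilon> + 1 / real n) * real n" for P
  proof -
    have "measure_pmf.prob (execution n A adv x (3 * m + K))
        {st. g / 2 * real n < card (bad P (fst st))}
      \<le> real m * exp (- real n * \<eta>\<^sup>2 / 4) + d"
    proof (rule bad_nodes_after_final_phase[where p = "1/2 - \<epsilon> + 1 / real n" and F = F
          and k = "growth_phases \<epsilon>" and j = "squaring_phases g" and \<kappa> = "final_length F g",
          folded m K])
      show "1 \<le> \<epsilon> * (6 / 5) ^ growth_phases \<epsilon>" using growth_phases(1) \<epsilon> by simp
      show "(13 / 24) ^ 2 ^ squaring_phases g \<le> 13 * F"
        using squaring_phases(1)[of g] TL BF by linarith
      show "3 * (2 * ln (1 / g) + ln 4) / ln (1 / F) \<le> real (final_length F g)"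
        unfolding g_def F_def by (rule final_length(1)[OF n \<gamma> \<beta>(1) \<beta>28])
    qed (use P init \<epsilon> \<beta> BF TL \<eta>F large dg in \<open>auto simp: \<eta>_def\<close>)
    then show ?thesis by (simp add: n\<eta> T)
  qed
  let ?H = "{st. g / 2 * real n < card (bad (too_high n x \<epsilon>) (fst st))}"
  let ?L = "{st. g / 2 * real n < card (bad (too_low n x \<epsilon>) (fst st))}"
  let ?S = "{y. correctness_level n x \<epsilon> \<gamma> y}"
  let ?out = "\<lambda>(\<sigma>, h) v. outcome A (\<sigma> v)"
  have "- (?out -` ?S) \<subseteq> ?H \<union> ?L"
  proof
    fix st assume "st \<in> - (?out -` ?S)"
    then have "\<not> correctness_level n x \<epsilon> \<gamma> (\<lambda>v. estimate (schedule m K) (fst st v))"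
      by (auto simp: median_algorithm_def case_prod_unfold)
    from correctness_failure[OF n \<gamma> this] show "st \<in> ?H \<union> ?L"
      by (auto simp: g_def bad_def)
  qed
  then have "measure_pmf.prob (execution n A adv x T) (- (?out -` ?S))
      \<le> measure_pmf.prob (execution n A adv x T) (?H \<union> ?L)"
    by (intro measure_pmf.finite_measure_mono) auto
  also have "\<dots> \<le> measure_pmf.prob (execution n A adv x T) ?H
      + measure_pmf.prob (execution n A adv x T) ?L"
    by (intro measure_Un_le) auto
  also have "\<dots> \<le> 2 * (real m * exp (- (real n powr (1/3)) / 4) + d)"
    unfolding mult_2
    by (rule add_mono[OF fail[OF majority_closed_too_high card_too_high[OF n_pos \<epsilon>(2)]]
        fail[OF majority_closed_too_low card_too_low[OF n_pos \<epsilon>(2)]]])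
  finally have "measure_pmf.prob (execution n A adv x T) (- (?out -` ?S))
      \<le> 2 * (real m * exp (- (real n powr (1/3)) / 4) + d)" .
  moreover have "measure_pmf.prob (execution n A adv x T) (- (?out -` ?S))
      = 1 - measure_pmf.prob (execution n A adv x T) (?out -` ?S)"
    using measure_pmf.prob_compl[of "?out -` ?S" "execution n A adv x T"]
    by (simp add: Compl_eq_Diff_UNIV)
  moreover have "measure_pmf.prob (outputs n A adv x T) ?S
      = measure_pmf.prob (execution n A adv x T) (?out -` ?S)"
    by (simp add: outputs_def)
  ultimately show ?thesis by (simp add: T_def)
qed

text \<open>The union bound over the phases has only \<open>O(ln n)\<close> terms, which the
  exponentially small error of each phase outweighs.\<close>

lemma tournament_phases_le:
  assumes n: "n \<ge> 1" and \<epsilon>: "real n powr (-1/100) \<le> \<epsilon>" "\<epsilon> < 1" and \<gamma>: "0 < \<gamma>" "\<gamma> < 1"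
  shows "real (tournament_phases n \<epsilon> \<gamma>) \<le> 9 + ln (real n) + 2 * ln (2 * real n)"
proof -
  note G = target_level[OF n \<gamma>]
  let ?L = "ln (1 / target_level n \<gamma>)"
  have p: "0 < real n powr (-1/100)" using n by simp
  then have \<epsilon>0: "0 < \<epsilon>" using \<epsilon> by linarith
  have "ln (real n powr (-1/100)) \<le> ln \<epsilon>" using p \<epsilon> by (intro ln_mono) auto
  then have "ln (1 / \<epsilon>) \<le> ln (real n) / 100" using n \<epsilon>0 by (simp add: ln_div ln_powr)
  moreover have "0 \<le> ln (real n)" using n by simp
  ultimately have 1: "6 * ln (1 / \<epsilon>) \<le> ln (real n)" by linarith
  have "ln (max 1 ?L) \<le> max 1 ?L - 1" by (rule ln_le_minus_one) simp
  also have "max 1 ?L \<le> 1 + ?L" using G by (intro max.boundedI) linarith+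
  also have "1 + ?L - 1 \<le> ln (2 * real n)" using G by simp
  finally have "real (squaring_phases (target_level n \<gamma>)) \<le> 3 + 2 * ln (2 * real n)"
    using squaring_phases(2)[of "target_level n \<gamma>"] G by linarith
  then show ?thesis
    using growth_phases(2)[OF \<epsilon>0 \<epsilon>(2)] 1 by (simp add: tournament_phases_def)
qed

theorem theorem1:
  fixes \<epsilon> \<beta> \<gamma> :: "nat \<Rightarrow> real" and k :: nat
  assumes "\<And>n. n \<ge> 1 \<Longrightarrow> \<epsilon> n \<in> {0<..<1}"
    and "\<And>n. n \<ge> 1 \<Longrightarrow> \<beta> n \<in> {0<..<1}"
    and "\<And>n. n \<ge> 1 \<Longrightarrow> \<gamma> n \<in> {0<..<1}"
    and "\<And>n. n \<ge> 1 \<Longrightarrow> \<beta> n \<le> \<epsilon> n / 14"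
    and "\<epsilon> \<in> \<Omega>(\<lambda>n. real n powr (- 0.0019))"
  shows "\<exists>(A :: nat \<Rightarrow> nat gossip_algorithm) (T :: nat \<Rightarrow> nat) (b :: nat \<Rightarrow> nat).
           (\<forall>n. message_size_le (A n) (b n)) \<and>
           (\<lambda>n. real (b n)) \<in> O(\<lambda>n. ln (real n)) \<and>
           (\<lambda>n. real (T n)) \<in> O(\<lambda>n. round_bound (\<epsilon> n) (\<beta> n) (\<gamma> n)) \<and>
           solves_approx_median_whp A T k \<epsilon> \<beta> \<gamma>"
proof -
  have "\<exists>c. is_codec (message_bits k n) (int n ^ k) c" for n
    by (intro codec_exists message_bits_sufficient) simp
  from choice[OF allI[OF this]] obtain c
    where codec: "\<forall>n. is_codec (message_bits k n) (int n ^ k) (c n)" ..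
  note c = is_codecD[OF codec[rule_format]]
  define A where "A n = median_algorithm (fst (c n)) (snd (c n))
    (schedule (tournament_phases n (\<epsilon> n) (\<gamma> n)) (final_samples n (\<beta> n) (\<gamma> n)))" for n
  define T where "T n = running_time n (\<epsilon> n) (\<beta> n) (\<gamma> n)" for n
  have size: "message_size_le (A n) (message_bits k n)" for n
    by (simp add: message_size_le_def A_def median_algorithm_def c)
  have time: "(\<lambda>n. real (T n)) \<in> O(\<lambda>n. round_bound (\<epsilon> n) (\<beta> n) (\<gamma> n))"
  proof (rule bigoI)
    show "\<forall>\<^sub>F n in sequentially. norm (real (T n)) \<le> 300 * norm (round_bound (\<epsilon> n) (\<beta> n) (\<gamma> n))"
      using eventually_ge_at_top[of 1]
    proof eventually_elim
      case (elim n)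
      have "real (T n) \<le> 300 * round_bound (\<epsilon> n) (\<beta> n) (\<gamma> n)"
        unfolding T_def using assms(1-4)[OF elim] elim by (intro running_time_le) auto
      then show ?case by simp
    qed
  qed
  \<comment> \<open>The unknown constant of the lower bound on \<open>\<epsilon>\<close> is absorbed
    by weakening the exponent from 0.0019 to \<open>1/100\<close>.\<close>
  have \<epsilon>_large: "\<forall>\<^sub>F n in sequentially. real n powr (-1/100) \<le> \<epsilon> n"
  proof -
    from assms(5) obtain C where C: "C > 0"
      "\<forall>\<^sub>F n in sequentially. norm (\<epsilon> n) \<ge> C * norm (real n powr (- 0.0019))"
      by (rule landau_omega.bigE)
    have "\<forall>\<^sub>F n in sequentially. real n powr (-1/100) \<le> C * real n powr (- 0.0019)"
      using C(1) by real_asymp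
    with C(2) eventually_ge_at_top[of 1] show ?thesis
    proof eventually_elim
      case (elim n)
      then show ?case using assms(1)[of n] by auto
    qed
  qed
  define d where "d n = exp (- (real n powr (1/2)) / 64) + 2 * real n powr (-1/4)" for n :: nat
  \<comment> \<open>The last of these estimates fixes the final exponent: the failure bound is
    dominated by a multiple of \<open>n powr (-1/4)\<close>, hence eventually below
    \<open>n powr (- (1/5))\<close>.\<close>
  have "\<forall>\<^sub>F n in sequentially. real n powr (-1/3) \<le> real n powr (-1/100) / 20"
    "\<forall>\<^sub>F n in sequentially. 1 / real n \<le> real n powr (-1/100) / 100"
    "\<forall>\<^sub>F n in sequentially. real n powr (-1/3) \<le> (real n powr (-1/8) / 28)\<^sup>2"
    "\<forall>\<^sub>F n in sequentially. 2 * ((9 + ln (real n) + 2 * ln (2 * real n)) *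
       exp (- (real n powr (1/3)) / 4) + d n) \<le> real n powr (- (1/5))"
    unfolding d_def by real_asymp+
  \<comment> \<open>The eventual estimates involve only \<open>n\<close> and
    \<open>\<epsilon> n\<close>, so the threshold for \<open>n\<close> is uniform in
    \<open>x\<close> and \<open>adv\<close>.\<close>
  then have "\<forall>\<^sub>F n in sequentially. \<forall>x (adv :: nat adversary).
        (\<forall>v < n. \<bar>x v\<bar> \<le> int n ^ k) \<longrightarrow> strong_adversary n (\<beta> n) adv \<longrightarrow>
        measure_pmf.prob (outputs n (A n) adv x (T n)) {y. correctness_level n x (\<epsilon> n) (\<gamma> n) y}
          \<ge> 1 - real n powr (- (1/5))"
    using \<epsilon>_large eventually_ge_at_top[of 1]
  proof eventually_elim
    case (elim n)
    show ?case
    proof (intro allI impI)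
      fix x :: "nat \<Rightarrow> int" and adv :: "nat adversary"
      assume x: "\<forall>v < n. \<bar>x v\<bar> \<le> int n ^ k" and adv: "strong_adversary n (\<beta> n) adv"
      note pars = assms(1-4)[OF elim(6)]
      show "measure_pmf.prob (outputs n (A n) adv x (T n)) {y. correctness_level n x (\<epsilon> n) (\<gamma> n) y}
          \<ge> 1 - real n powr (- (1/5))"
      proof (cases "1 / 2 \<le> \<epsilon> n")
        case True
        have "{v. v < n \<and> \<not> approx_median n x (\<epsilon> n) (x v)} = {}"
          using approx_median_initial_value[OF True] by blast
        then have "correctness_level n x (\<epsilon> n) (\<gamma> n) x"
          unfolding correctness_level_def using pars by (simp only:) simp
        then have "measure_pmf.prob (outputs n (A n) adv x (T n))
            {y. correctness_level n x (\<epsilon> n) (\<gamma> n) y} = 1"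
          using True by (simp add: T_def running_time_def outputs_def A_def median_algorithm_def
            estimate_def)
        then show ?thesis by simp
      next
        case False
        let ?m = "tournament_phases n (\<epsilon> n) (\<gamma> n)"
        have \<epsilon>: "0 < \<epsilon> n" "\<epsilon> n < 1" "\<epsilon> n < 1 / 2" and \<gamma>: "0 < \<gamma> n" "\<gamma> n < 1"
          and \<beta>: "0 < \<beta> n" "\<beta> n \<le> \<epsilon> n / 14"
          using pars False by auto
        have gossip: "median_gossip n (fst (c n)) (snd (c n)) (int n ^ k) x adv (\<beta> n)"
          using c(2,3) x adv elim(6) by unfold_locales auto
        have large: "1 / real n \<le> \<epsilon> n / 100" "real n powr (-1/3) \<le> \<epsilon> n / 20"
          using elim(1,2,5) by linarith+
        have "1 - 2 * (real ?m * exp (- (real n powr (1/3)) / 4) + d n) \<le>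
          measure_pmf.prob (outputs n (A n) adv x (T n)) {y. correctness_level n x (\<epsilon> n) (\<gamma> n) y}"
          unfolding A_def T_def
          by (rule median_algorithm_correct[OF gossip elim(6) \<epsilon>(1,3) \<gamma> \<beta> large elim(3)])
             (simp_all add: d_def)
        moreover have "real ?m * exp (- (real n powr (1/3)) / 4)
            \<le> (9 + ln (real n) + 2 * ln (2 * real n)) * exp (- (real n powr (1/3)) / 4)"
          by (rule mult_right_mono[OF tournament_phases_le[OF elim(6,5) \<epsilon>(2) \<gamma>]]) simp
        then have "2 * (real ?m * exp (- (real n powr (1/3)) / 4) + d n) \<le> real n powr (- (1/5))"
          by (intro order_trans[OF _ elim(4)] mult_left_mono add_right_mono) simp_all
        ultimately show ?thesis by (meson diff_left_mono order_trans)
      qed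
    qed
  qed
  then have "solves_approx_median_whp A T k \<epsilon> \<beta> \<gamma>"
    unfolding solves_approx_median_whp_def by (intro exI[of _ "1/5"]) simp
  then show ?thesis using size message_bits_bigo time by blast
qed

end
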